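(* For all $n\ge0$, $$\sum_{a=0}^{n}k(3n-a;\,a,a)=T(n).$$ Moreover, for $0\le a\le n$, $$k(3n-a;\,a,a)=K(n)\cdot\frac{(a+1)!\,(2a+1)!\,n!\,(3n-a)!}{4^{a}(a!)^{3}(n-a)!\,(3n)!},$$ and the diagonal generating function $Q_d(x;t):=\sum_{m,a\ge0}k(m;a,a)\,x^{a}t^{m}$ is algebraic, given by $$Q_d(x;t)=\frac{1}{\sqrt{1-xU^{2}}}\left(\frac{U}{2t}+\frac{\sqrt{1-xU^{2}}-1+\tfrac12xU^{2}}{t\,x^{2}}\right),$$ where $U\equiv U(t)$ is the unique power series in $t$ with $U=t(2+U^{3})$.
   Context: For integers $m,i,j\ge0$, $k(m;i,j)$ denotes the number of reverse Kreweras walks of length $m$ from $(0,0)$ to $(i,j)$: lattice walks staying in the quarter plane $\{(x,y):x,y\ge0\}$ with steps $(1,0)$, $(0,1)$, $(-1,-1)$. Further $$K(n)=\frac{4^{n}(3n)!}{(n+1)!\,(2n+1)!},\qquad T(n)=\frac{7n+5}{5}\prod_{k=1}^{n}\frac{6(2k-1)(6k-1)(6k+1)}{(k+1)(4k+3)(4k+5)}.$$ Square roots denote the branch with constant term $1$, as formal power series. *)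

theory Defs
  imports "HOL-Computational_Algebra.Computational_Algebra" "HOL-Library.Product_Plus"
begin

unbundle fps_syntax

definition rk_steps :: "(int \<times> int) set" where
  "rk_steps = {(1, 0), (0, 1), (-1, -1)}"

text \<open>
  A walk starting at the origin is encoded as the list of its steps; its successive positions
  are the sums of the prefixes of that list.
\<close>

definition rk_walks :: "nat \<Rightarrow> nat \<Rightarrow> nat \<Rightarrow> (int \<times> int) list set" where
  "rk_walks m i j = {w. length w = m \<and> set w \<subseteq> rk_steps \<and>
     (\<forall>l\<le>m. sum_list (take l w) \<in> {0..} \<times> {0..}) \<and> sum_list w = (int i, int j)}"

definition rk :: "nat \<Rightarrow> nat \<Rightarrow> nat \<Rightarrow> nat" where
  "rk m i j = card (rk_walks m i j)"

definition K :: "nat \<Rightarrow> rat" where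
  "K n = 4 ^ n * fact (3 * n) / (fact (n + 1) * fact (2 * n + 1))"

definition T :: "nat \<Rightarrow> rat" where
  "T n = (7 * of_nat n + 5) / 5 *
     (\<Prod>k=1..n. 6 * (2 * of_nat k - 1) * (6 * of_nat k - 1) * (6 * of_nat k + 1) /
        ((of_nat k + 1) * (4 * of_nat k + 3) * (4 * of_nat k + 5)))"

text \<open>
  Power series in \<open>x\<close> and \<open>t\<close> are elements of \<open>rat fps fps\<close>: the outer variable is \<open>t\<close>, the
  inner one is \<open>x\<close>, so \<open>F $ m $ a\<close> is the coefficient of \<open>x\<^sup>a t\<^sup>m\<close>.
\<close>

definition ser_t :: "rat fps fps" where
  "ser_t = fps_X"

definition ser_x :: "rat fps fps" where
  "ser_x = fps_const fps_X"

text \<open>A series in \<open>t\<close> alone, regarded as a series in \<open>x\<close> and \<open>t\<close>.\<close>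

definition in_t :: "rat fps \<Rightarrow> rat fps fps" where
  "in_t F = Abs_fps (\<lambda>m. fps_const (F $ m))"

definition ser_sqrt :: "rat fps fps \<Rightarrow> rat fps fps" where
  "ser_sqrt F = (THE S. S\<^sup>2 = F \<and> S $ 0 $ 0 = 1)"

definition Qd :: "rat fps fps" where
  "Qd = Abs_fps (\<lambda>m. Abs_fps (\<lambda>a. of_nat (rk m a a)))"

text \<open>
  A polynomial in \<open>x\<close> (inner variable) and \<open>t\<close> (outer variable), regarded as a power series.
\<close>

definition ser_of_poly :: "rat poly poly \<Rightarrow> rat fps fps" where
  "ser_of_poly p = fps_of_poly (map_poly fps_of_poly p)"

text \<open>
  Algebraicity over \<open>\<rat>(x, t)\<close>: being a root of a nonzero polynomial whose coefficients may be
  taken in \<open>\<rat>[x, t]\<close>.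
\<close>

definition algebraic_series :: "rat fps fps \<Rightarrow> bool" where
  "algebraic_series F \<longleftrightarrow>
     (\<exists>P :: rat poly poly poly. P \<noteq> 0 \<and> poly (map_poly ser_of_poly P) F = 0)"

end

theory Submission
  imports Defs
begin

text \<open>
  The proof is an instance of the algebraic kernel method. Let \<open>Q(x, y)\<close> be the generating function of
  all reverse Kreweras walks and \<open>K = 1 - t (x + y + 1/(xy))\<close>. From
  \<open>K x y Q(x, y) = x y - t Q(x, 0) - t Q(0, y) + t Q(0, 0)\<close>, its images under permutations of
  \<open>x, y, 1/(xy)\<close>, and the symmetry of \<open>Q\<close>, one gets
  \<open>K (x y Q(x, y) - x\<^sup>-\<^sup>1 Q(1/(xy), y) + y\<^sup>-\<^sup>1 Q(1/(xy), x)) = x y - x\<^sup>-\<^sup>1 + y\<^sup>-\<^sup>1 - 2 t Q(x, 0) + t Q(0, 0)\<close>.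
  The coefficient of \<open>y\<^sup>0\<close> in the bracket is \<open>- x\<^sup>-\<^sup>1 Q\<^sub>d(1/x)\<close>. Dividing by \<open>K\<close> and extracting this
  coefficient (\<open>kernel_method\<close>) relates \<open>Q\<^sub>d(1/x)\<close> and \<open>Q(x, 0)\<close> through the square root of the
  discriminant \<open>(1 - t x)\<^sup>2 - 4 t\<^sup>2/x\<close>.

  The discriminant times \<open>(2 + U\<^sup>3)\<^sup>2 / 4\<close> is the product of \<open>1 - U\<^sup>2/x\<close> and a polynomial in \<open>x\<close> with
  constant term 1. Giving each factor to the side with the matching sign of exponents separates the
  equation: both sides are then Laurent polynomials with three terms
  (\<open>factor_separation\<close>, \<open>diagonal_equation\<close>), and solving for \<open>Q\<^sub>d\<close> gives its closed form.

  The numbers on the diagonal follow by expanding \<open>(1 - x U\<^sup>2)\<^sup>-\<^sup>1\<^sup>/\<^sup>2\<close> and inserting the coefficients of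
  the powers of \<open>U\<close> (\<open>cubic_series_power_nth\<close>). The sum over \<open>a\<close> reduces to the Chu-Vandermonde
  identity for rising factorials (\<open>rk_diagonal_sum\<close>). Algebraicity is witnessed by an explicit
  determinant that eliminates \<open>U\<close> and the square root (\<open>eliminant_eq_0\<close>).
\<close>

unbundle fps_syntax

section \<open>Counting walks and the half-orbit sum\<close>

text \<open>
  The walks of length \<open>m\<close> from the origin to the integer point \<open>p\<close>. Allowing endpoints outside the
  quadrant, where the set is empty, lets the step recurrence hold at every point of the plane up to
  an explicit boundary term.
\<close>

definition walks_to :: "nat \<Rightarrow> int \<times> int \<Rightarrow> (int \<times> int) list set" where
  "walks_to m p = {w. length w = m \<and> set w \<subseteq> rk_steps \<and>
     (\<forall>l\<le>m. sum_list (take l w) \<in> {0..} \<times> {0..}) \<and> sum_list w = p}"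

text \<open>
  The number of these walks, as a rational number because it serves as a coefficient of power series.
\<close>

definition walk_count :: "nat \<Rightarrow> int \<Rightarrow> int \<Rightarrow> rat" where
  "walk_count m i j = of_nat (card (walks_to m (i, j)))"

lemma rk_eq_walk_count: "of_nat (rk m i j) = walk_count m (int i) (int j)"
  by (simp add: rk_def rk_walks_def walk_count_def walks_to_def)

lemma walks_to_outside: "p \<notin> {0..} \<times> {0..} \<Longrightarrow> walks_to m p = {}"
  by (auto simp: walks_to_def dest!: spec[where x = m])

lemma finite_walks_to: "finite (walks_to m p)"
proof (rule finite_subset)
  show "walks_to m p \<subseteq> {w. set w \<subseteq> rk_steps \<and> length w = m}"
    by (auto simp: walks_to_def)
  show "finite {w. set w \<subseteq> rk_steps \<and> length w = m}"
    by (rule finite_lists_length_eq) (simp add: rk_steps_def)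
qed

lemma walks_to_Suc:
  assumes "p \<in> {0..} \<times> {0..}"
  shows "walks_to (Suc m) p = (\<Union>s\<in>rk_steps. (\<lambda>w. w @ [s]) ` walks_to m (p - s))"
proof (intro equalityI subsetI)
  fix w assume w: "w \<in> walks_to (Suc m) p"
  then obtain v s where vs: "w = v @ [s]" "length v = m"
    by (auto simp: walks_to_def length_Suc_conv_rev)
  have "sum_list (take l v) \<in> {0..} \<times> {0..}" if "l \<le> m" for l
  proof -
    have "sum_list (take l w) \<in> {0..} \<times> {0..}"
      using w that unfolding walks_to_def by fastforce
    then show ?thesis using that vs by simp
  qed
  then have "v \<in> walks_to m (p - s)" and "s \<in> rk_steps"
    using w vs by (auto simp: walks_to_def)
  then show "w \<in> (\<Union>s\<in>rk_steps. (\<lambda>w. w @ [s]) ` walks_to m (p - s))"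
    using vs by blast
next
  fix w assume "w \<in> (\<Union>s\<in>rk_steps. (\<lambda>w. w @ [s]) ` walks_to m (p - s))"
  then obtain v s where vs: "w = v @ [s]" "s \<in> rk_steps" "v \<in> walks_to m (p - s)"
    by blast
  have "sum_list (take l w) \<in> {0..} \<times> {0..}" if "l \<le> Suc m" for l
  proof (cases "l = Suc m")
    case True
    then show ?thesis using vs assms by (simp add: walks_to_def)
  next
    case False
    then show ?thesis using vs that by (simp add: walks_to_def le_Suc_eq)
  qed
  then show "w \<in> walks_to (Suc m) p"
    using vs by (auto simp: walks_to_def)
qed

lemma walk_count_0: "walk_count 0 i j = (if i = 0 \<and> j = 0 then 1 else 0)"
proof -
  have "walks_to 0 (i, j) = (if i = 0 \<and> j = 0 then {[]} else {})"
    by (auto simp: walks_to_def zero_prod_def)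
  then show ?thesis by (simp add: walk_count_def)
qed

lemma walk_count_outside: "i < 0 \<or> j < 0 \<Longrightarrow> walk_count m i j = 0"
  by (auto simp: walk_count_def walks_to_outside)

lemma walk_count_Suc:
  assumes "i \<ge> 0" "j \<ge> 0"
  shows "walk_count (Suc m) i j =
    walk_count m (i - 1) j + walk_count m i (j - 1) + walk_count m (i + 1) (j + 1)"
proof -
  have fin: "finite rk_steps" by (simp add: rk_steps_def)
  have "card (walks_to (Suc m) (i, j)) =
      card (\<Union>s\<in>rk_steps. (\<lambda>w. w @ [s]) ` walks_to m ((i, j) - s))"
    using assms by (subst walks_to_Suc) simp_all
  also have "\<dots> = (\<Sum>s\<in>rk_steps. card ((\<lambda>w. w @ [s]) ` walks_to m ((i, j) - s)))"
    by (rule card_UN_disjoint[OF fin]) (use finite_walks_to in blast)+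
  also have "\<dots> = (\<Sum>s\<in>rk_steps. card (walks_to m ((i, j) - s)))"
    by (intro sum.cong refl card_image) (auto simp: inj_on_def)
  finally show ?thesis by (simp add: walk_count_def rk_steps_def)
qed

text \<open>
  The subtracted term removes the steps \<open>(-1, -1)\<close> that leave the quadrant from one of the axes.
\<close>

lemma walk_count_rec:
  "walk_count (Suc m) i j =
    walk_count m (i - 1) j + walk_count m i (j - 1) + walk_count m (i + 1) (j + 1)
    - (if i = -1 \<or> j = -1 then walk_count m (i + 1) (j + 1) else 0)"
proof (cases "i \<ge> 0 \<and> j \<ge> 0")
  case True
  then show ?thesis by (simp add: walk_count_Suc)
next
  case False
  then have "i = -1 \<or> j = -1 \<or> i + 1 < 0 \<or> j + 1 < 0" by linarith
  with False show ?thesis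
    using walk_count_outside[of i j "Suc m"] walk_count_outside[of "i - 1" j m]
      walk_count_outside[of i "j - 1" m] walk_count_outside[of "i + 1" "j + 1" m]
    by auto
qed

lemma walk_count_commute: "walk_count m i j = walk_count m j i"
proof (induction m arbitrary: i j)
  case 0
  show ?case by (auto simp: walk_count_0)
next
  case (Suc m)
  show ?case
    unfolding walk_count_rec[of m i j] walk_count_rec[of m j i] disj_commute[of "j = -1"]
      Suc[of "i - 1" j] Suc[of i "j - 1"] Suc[of "i + 1" "j + 1"]
    by (simp only: add.commute)
qed

lemma walk_count_eq_0: "i > int m \<or> j > int m \<Longrightarrow> walk_count m i j = 0"
proof (induction m arbitrary: i j)
  case 0
  then show ?case by (auto simp: walk_count_0)
next
  case (Suc m)
  have "walk_count m (i - 1) j = 0" "walk_count m i (j - 1) = 0" "walk_count m (i + 1) (j + 1) = 0"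
    using Suc by auto
  then show ?case unfolding walk_count_rec by simp
qed

text \<open>
  Write \<open>Q(x, y)\<close> for the generating function of all walks. The step polynomial \<open>x + y + 1/(xy)\<close> is
  invariant under permutations of \<open>x\<close>, \<open>y\<close>, \<open>1/(xy)\<close>. The number \<open>orbit_count m i j\<close> is the
  coefficient of \<open>t\<^sup>m x\<^sup>i y\<^sup>j\<close> in the half-orbit sum
  \<open>x y Q(x, y) - x\<^sup>-\<^sup>1 Q(1/(xy), y) + y\<^sup>-\<^sup>1 Q(1/(xy), x)\<close>.
\<close>

definition orbit_count :: "nat \<Rightarrow> int \<Rightarrow> int \<Rightarrow> rat" where
  "orbit_count m i j = walk_count m (i - 1) (j - 1) - walk_count m (- 1 - i) (j - 1 - i)
     + walk_count m (- 1 - j) (i - 1 - j)"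

lemma orbit_count_0:
  "orbit_count 0 i j = (if i = 1 \<and> j = 1 then 1 else 0) - (if i = -1 \<and> j = 0 then 1 else 0)
     + (if i = 0 \<and> j = -1 then 1 else 0)"
  by (auto simp: orbit_count_def walk_count_0)

text \<open>
  In the half-orbit sum all boundary terms cancel except those on the row \<open>j = 0\<close>.
\<close>

lemma orbit_count_Suc:
  "orbit_count (Suc m) i j =
     orbit_count m (i - 1) j + orbit_count m i (j - 1) + orbit_count m (i + 1) (j + 1)
     + (if j = 0 then (if i = 0 then walk_count m 0 0 else 0) - 2 * walk_count m i 0 else 0)"
proof -
  \<comment> \<open>The boundary term of \<open>walk_count_rec\<close>.\<close>
  let ?d = "\<lambda>i j. if i = -1 \<or> j = -1 then walk_count m (i + 1) (j + 1) else 0"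
  have "- ?d (i - 1) (j - 1) + ?d (-1 - i) (j - 1 - i) - ?d (-1 - j) (i - 1 - j) =
     (if j = 0 then (if i = 0 then walk_count m 0 0 else 0) - 2 * walk_count m i 0 else 0)"
  proof -
    consider "i = 0" "j = 0" | "i = 0" "j \<noteq> 0" | "i \<noteq> 0" "j = 0"
      | "i = j" "j \<noteq> 0" | "i \<noteq> 0" "j \<noteq> 0" "i \<noteq> j" by blast
    then show ?thesis
    proof cases
      case 2
      then show ?thesis using walk_count_commute[of m 0 j] walk_count_outside[of j "j - 1" m]
          walk_count_outside[of "-j" "-j" m] by simp
    next
      case 3
      then show ?thesis using walk_count_commute[of m 0 i] by simp
    next
      case 4
      then show ?thesis using walk_count_commute[of m 0 "- j"] by simp
    qed auto
  qed
  then show ?thesis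
    unfolding orbit_count_def
    unfolding walk_count_rec[of m "i - 1" "j - 1"] walk_count_rec[of m "-1 - i" "j - 1 - i"]
      walk_count_rec[of m "-1 - j" "i - 1 - j"]
    by (simp add: algebra_simps)
qed

lemma orbit_count_eq_0:
  assumes "i > int m + 1 + \<bar>j\<bar>"
  shows "orbit_count m i j = 0"
proof -
  have "walk_count m (i - 1) (j - 1) = 0"
    by (rule walk_count_eq_0) (use assms in linarith)
  moreover have "walk_count m (- 1 - i) (j - 1 - i) = 0"
    by (rule walk_count_outside) (use assms in linarith)
  moreover have "walk_count m (- 1 - j) (i - 1 - j) = 0"
    by (rule walk_count_eq_0) (use assms in linarith)
  ultimately show ?thesis by (simp add: orbit_count_def)
qed

text \<open>
  Among the three summands only \<open>- x\<^sup>-\<^sup>1 Q(1/(xy), y)\<close> contributes to \<open>y\<^sup>0\<close>, and it contributes the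
  diagonal of \<open>Q\<close>.
\<close>

lemma orbit_count_row_0: "orbit_count m i 0 = - walk_count m (- 1 - i) (- 1 - i)"
  by (simp add: orbit_count_def walk_count_outside)

section \<open>The kernel method\<close>

text \<open>
  The coefficients of the half-orbit sum in \<open>t\<close> and \<open>y\<close> are Laurent polynomials in \<open>x\<close>. They are
  embedded into the field of Laurent series in \<open>z = 1/x\<close>, so that the exponent of \<open>fls_X\<close> is minus the exponent of \<open>x\<close> and the
  diagonal series, taken at \<open>1/x\<close>, has no negative exponents.
\<close>

abbreviation (input) sx :: "rat fls fps" where "sx \<equiv> fps_const fls_X_inv"
abbreviation (input) sz :: "rat fls fps" where "sz \<equiv> fps_const fls_X"
abbreviation (input) st :: "rat fls fps" where "st \<equiv> fps_X"

lemma sx_sz: "sx * sz = 1"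
  by (simp add: fls_X_inv_times_conv_shift)

lemma sx_mult_nth: "(sx * F) $ m $$ n = F $ m $$ (n + 1)"
  by (simp add: fls_X_inv_times_conv_shift)

lemma sz_mult_nth: "(sz * F) $ m $$ n = F $ m $$ (n - 1)"
  by (simp add: fls_X_times_conv_shift)

text \<open>
  The coefficient of \<open>y\<^sup>j\<close> in the half-orbit sum, as a series in \<open>t\<close> over the Laurent series in \<open>z\<close>.
\<close>

definition orbit_row :: "int \<Rightarrow> rat fls fps" where
  "orbit_row j = Abs_fps (\<lambda>m. Abs_fls (\<lambda>n. orbit_count m (- n) j))"

lemma orbit_row_nth: "orbit_row j $ m $$ n = orbit_count m (- n) j"
  unfolding orbit_row_def fps_nth_Abs_fps
  by (rule nth_Abs_fls_lower_bound[of "- (int m + 1 + \<bar>j\<bar>)"]) (auto intro: orbit_count_eq_0)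

text \<open>
  The series \<open>Q(x, 0)\<close> of the walks that end on the horizontal axis.
\<close>

definition axis_series :: "rat fls fps" where
  "axis_series = Abs_fps (\<lambda>m. Abs_fls (\<lambda>n. walk_count m (- n) 0))"

lemma axis_series_nth: "axis_series $ m $$ n = walk_count m (- n) 0"
  unfolding axis_series_def fps_nth_Abs_fps
  by (rule nth_Abs_fls_lower_bound[of "- int m"]) (auto intro: walk_count_eq_0)

text \<open>
  The series \<open>Q(0, 0)\<close> of the walks that return to the origin.
\<close>

definition origin_series :: "rat fls fps" where
  "origin_series = Abs_fps (\<lambda>m. fls_const (walk_count m 0 0))"

lemma two_mult_nth: "(2 * F) $ m $$ n = 2 * (F $ m $$ n)" for F :: "rat fls fps"
  by (simp only: mult_2 fps_add_nth fls_plus_nth)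

lemma orbit_row_rec:
  "orbit_row j =
     (if j = 1 then sx else if j = -1 then 1
      else if j = 0 then - sz - 2 * (st * axis_series) + st * origin_series else 0)
     + st * (sx * orbit_row j + orbit_row (j - 1) + sz * orbit_row (j + 1))"
proof (rule fps_ext, rule fls_eqI)
  fix m n
  let ?N = "if j = 1 then sx else if j = -1 then 1
      else if j = 0 then - sz - 2 * (st * axis_series) + st * origin_series else 0"
  let ?S = "sx * orbit_row j + orbit_row (j - 1) + sz * orbit_row (j + 1)"
  show "orbit_row j $ m $$ n = (?N + st * ?S) $ m $$ n"
  proof (cases m)
    case 0
    have "?N $ 0 $$ n = (if j = 1 \<and> n = -1 then 1 else if j = -1 \<and> n = 0 then 1
        else if j = 0 \<and> n = 1 then -1 else 0)"
      by (simp add: two_mult_nth)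
    then show ?thesis
      unfolding 0 fps_add_nth fls_plus_nth orbit_row_nth orbit_count_0 by simp
  next
    case (Suc k)
    have "?N $ Suc k $$ n = (if j = 0 then (if n = 0 then walk_count k 0 0 else 0)
        - 2 * walk_count k (- n) 0 else 0)"
      by (simp add: two_mult_nth axis_series_nth origin_series_def)
    moreover have "(st * ?S) $ Suc k $$ n = orbit_count k (- n - 1) j + orbit_count k (- n) (j - 1)
        + orbit_count k (- n + 1) (j + 1)"
      by (simp only: fps_X_mult_nth nat.simps if_False diff_Suc_1
          fps_add_nth fls_plus_nth sx_mult_nth sz_mult_nth orbit_row_nth) simp
    ultimately show ?thesis
      unfolding Suc fps_add_nth fls_plus_nth orbit_row_nth orbit_count_Suc by simp
  qed
qed

text \<open>
  Every member of such a chain is divisible by all powers of the variable.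
\<close>

lemma fps_eq_0_if_X_chain:
  fixes F :: "nat \<Rightarrow> 'a :: comm_semiring_1 fps"
  assumes "\<And>j. F j = fps_X * (e * F (Suc j))"
  shows "F j = 0"
proof -
  have "\<forall>j. \<forall>i\<le>m. F j $ i = 0" for m
  proof (induction m)
    case 0
    show ?case by (subst assms) simp
  next
    case (Suc m)
    have "F j $ Suc m = 0" for j
    proof -
      have "F j $ Suc m = (e * F (Suc j)) $ m" by (subst assms) simp
      also have "\<dots> = 0" using Suc by (simp add: fps_mult_nth)
      finally show ?thesis .
    qed
    with Suc show ?case by (simp add: le_Suc_eq)
  qed
  then show ?thesis by (intro fps_ext) auto
qed

text \<open>
  The recurrence for the rows is linear with characteristic equation \<open>\<mu> = t (z + x \<mu> + \<mu>\<^sup>2)\<close>, whose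
  root \<open>\<mu>\<close> is a power series in \<open>t\<close>. As all rows are power series in \<open>t\<close>, only the solution of the
  recurrence decaying in both directions survives: away from row 0, passing to the next row multiplies
  by \<open>x \<mu>\<close> upwards and by \<open>\<mu>\<close> downwards. The defects from this behaviour form chains to which the
  previous lemma applies. Substitution into the equation for row 0 leaves a relation between the
  diagonal and \<open>Q(x, 0)\<close> only.
\<close>

lemma kernel_method:
  fixes \<mu> :: "rat fls fps"
  assumes mu: "\<mu> = st * (sz + sx * \<mu> + \<mu>\<^sup>2)"
  shows "(1 - st * sx - 2 * st * \<mu>) * orbit_row 0 =
    - sz - 2 * (st * axis_series) + st * origin_series + 2 * sx * \<mu>"
proof -
  define x z t where "x = sx" and "z = sz" and "t = st"
  have xz: "x * z = 1" unfolding x_def z_def by (rule sx_sz)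
  define A where "A = 1 - t * x - t * \<mu>"
  have mu': "A * \<mu> = t * z"
    using mu unfolding A_def t_def[symmetric] x_def[symmetric] z_def[symmetric] by algebra
  have Ax: "A * (x * \<mu>) = t"
    using mu' xz by algebra
  have A0: "A $ 0 = 1" by (simp add: A_def t_def)
  then have Anz: "A \<noteq> 0" by auto
  then obtain B where Ainv: "B * A = 1" using A0 inverse_mult_eq_1[of A] by auto
  define G where "G = orbit_row"
  note rec = orbit_row_rec[folded G_def x_def z_def t_def]
  \<comment> \<open>The defects \<open>D\<close> above row 1 and \<open>E\<close> below row \<open>-1\<close> vanish.\<close>
  define D where "D j = G (int j + 2) - x * \<mu> * G (int j + 1)" for j :: nat
  have "D j = t * ((B * z) * D (Suc j))" for j
  proof -
    have "G (int j + 2) = t * (x * G (int j + 2) + G (int j + 1) + z * G (int j + 3))"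
    proof -
      have e: "int j + 2 - 1 = int j + 1" "int j + 2 + 1 = int j + 3" by simp_all
      have "int j + 2 \<noteq> 1" "int j + 2 \<noteq> -1" "int j + 2 \<noteq> 0" by simp_all
      then show ?thesis using rec[of "int j + 2"] by (simp only: e if_False add_0)
    qed
    moreover have "z * G (int j + 3) = \<mu> * G (int j + 2) + z * D (Suc j)"
    proof -
      have "int (Suc j) + 2 = int j + 3" "int (Suc j) + 1 = int j + 2" by simp_all
      then have "D (Suc j) = G (int j + 3) - x * \<mu> * G (int j + 2)" by (simp only: D_def)
      then show ?thesis using xz by algebra
    qed
    ultimately have "A * G (int j + 2) = t * G (int j + 1) + t * (z * D (Suc j))"
      unfolding A_def by algebra
    then have "A * D j = t * (z * D (Suc j))"
      using Ax unfolding D_def by algebra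
    then show ?thesis using Ainv by algebra
  qed
  then have D0: "D j = 0" for j unfolding t_def by (rule fps_eq_0_if_X_chain)
  define E where "E j = G (- int j - 2) - \<mu> * G (- int j - 1)" for j :: nat
  have "E j = t * (B * E (Suc j))" for j
  proof -
    have "G (- int j - 2) = t * (x * G (- int j - 2) + G (- int j - 3) + z * G (- int j - 1))"
    proof -
      have e: "- int j - 2 - 1 = - int j - 3" "- int j - 2 + 1 = - int j - 1" by simp_all
      have "- int j - 2 \<noteq> 1" "- int j - 2 \<noteq> -1" "- int j - 2 \<noteq> 0" by simp_all
      then show ?thesis using rec[of "- int j - 2"] by (simp only: e if_False add_0)
    qed
    moreover have "G (- int j - 3) = \<mu> * G (- int j - 2) + E (Suc j)"
    proof -
      have "- int (Suc j) - 2 = - int j - 3" "- int (Suc j) - 1 = - int j - 2" by simp_all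
      then have "E (Suc j) = G (- int j - 3) - \<mu> * G (- int j - 2)" by (simp only: E_def)
      then show ?thesis by algebra
    qed
    ultimately have "A * G (- int j - 2) = t * z * G (- int j - 1) + t * E (Suc j)"
      unfolding A_def by algebra
    then have "A * E j = t * E (Suc j)"
      using mu' unfolding E_def by algebra
    then show ?thesis using Ainv by algebra
  qed
  then have E0: "E j = 0" for j unfolding t_def by (rule fps_eq_0_if_X_chain)
  have up: "t * z * G 1 = \<mu> * t * G 0 + x * \<mu>"
  proof -
    have "G 1 = x + t * (x * G 1 + G 0 + z * G 2)" using rec[of 1] by simp
    moreover have "G 2 - x * \<mu> * G 1 = 0" using D0[of 0] by (simp add: D_def)
    then have "z * G 2 = \<mu> * G 1" using xz by algebra
    ultimately have "A * G 1 = x + t * G 0" unfolding A_def by algebra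
    then have "A * (t * z * G 1) = t * z * x + t * z * t * G 0" by algebra
    also have "\<dots> = A * (\<mu> * t * G 0 + x * \<mu>)"
      using mu' Ax xz by algebra
    finally show ?thesis using Anz by simp
  qed
  have down: "t * G (-1) = \<mu> * t * G 0 + x * \<mu>"
  proof -
    have "G (-1) = 1 + t * (x * G (-1) + G (-2) + z * G 0)" using rec[of "-1"] by simp
    moreover have "G (-2) = \<mu> * G (-1)"
      using E0[of 0] by (simp add: E_def)
    ultimately have "A * G (-1) = 1 + t * z * G 0" unfolding A_def by algebra
    then have "A * (t * G (-1)) = t + t * (t * z) * G 0" by algebra
    also have "\<dots> = A * (\<mu> * t * G 0 + x * \<mu>)"
      using mu' Ax by algebra
    finally show ?thesis using Anz by simp
  qed
  have "G 0 = - z - 2 * (t * axis_series) + t * origin_series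
      + (t * x * G 0 + t * G (-1) + t * z * G 1)"
  proof -
    have "G 0 = - z - 2 * (t * axis_series) + t * origin_series
        + t * (x * G 0 + G (-1) + z * G 1)" using rec[of 0] by simp
    then show ?thesis by algebra
  qed
  then have "(1 - t * x - 2 * t * \<mu>) * G 0 =
     - z - 2 * (t * axis_series) + t * origin_series + 2 * x * \<mu>"
    using up down by algebra
  then show ?thesis unfolding G_def x_def z_def t_def .
qed

text \<open>
  The substitution of \<open>z\<close> for \<open>ser_x\<close>, from power series to series over the Laurent series in \<open>z\<close>.
\<close>

definition lift_series :: "rat fps fps \<Rightarrow> rat fls fps" where
  "lift_series F = Abs_fps (\<lambda>m. fps_to_fls (F $ m))"

lemma lift_series_nth: "lift_series F $ m $$ n = (if n < 0 then 0 else F $ m $ nat n)"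
  by (simp add: lift_series_def)

lemma fps_to_fls_sum: "fps_to_fls (\<Sum>i\<in>A. f i) = (\<Sum>i\<in>A. fps_to_fls (f i))"
  by (induction A rule: infinite_finite_induct) simp_all

lemma lift_series_add: "lift_series (F + G) = lift_series F + lift_series G"
  by (rule fps_ext) (simp add: lift_series_def)

lemma lift_series_diff: "lift_series (F - G) = lift_series F - lift_series G"
  by (rule fps_ext) (simp add: lift_series_def)

lemma lift_series_mult: "lift_series (F * G) = lift_series F * lift_series G"
  by (rule fps_ext)
     (simp add: lift_series_def fps_mult_nth fps_to_fls_sum fls_times_fps_to_fls)

lemma lift_series_1: "lift_series 1 = 1"
  by (rule fps_ext) (simp add: lift_series_def)

lemma lift_series_power: "lift_series (F ^ n) = lift_series F ^ n"
  by (induction n) (simp_all add: lift_series_1 lift_series_mult)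

lemma lift_series_x: "lift_series ser_x = sz"
  by (rule fps_ext) (auto simp: lift_series_def ser_x_def)

lemma lift_series_t: "lift_series ser_t = st"
  by (rule fps_ext) (auto simp: lift_series_def ser_t_def fps_X_def)

lemma orbit_row_0: "orbit_row 0 = - (sz * lift_series Qd)"
proof (rule fps_ext, rule fls_eqI)
  fix m n
  have "(sz * lift_series Qd) $ m $$ n = walk_count m (n - 1) (n - 1)"
    by (simp add: sz_mult_nth lift_series_nth Qd_def rk_eq_walk_count walk_count_outside del: fps_mult_left_const_nth)
  then show "orbit_row 0 $ m $$ n = (- (sz * lift_series Qd)) $ m $$ n"
    by (simp add: orbit_row_nth orbit_count_row_0 del: fps_mult_left_const_nth)
qed

text \<open>
  The factor \<open>s = 1 - t x - 2 t \<mu>\<close> is the square root of the discriminant \<open>(1 - t x)\<^sup>2 - 4 t\<^sup>2 z\<close> of the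
  kernel. Rearranged, the kernel equation has the diagonal on the left, with exponents of \<open>z\<close> bounded
  below, and \<open>Q(x, 0)\<close> on the right, with exponents of \<open>z\<close> bounded above.
\<close>

lemma separated_equation:
  fixes \<mu> :: "rat fls fps"
  assumes mu: "\<mu> = st * (sz + sx * \<mu> + \<mu>\<^sup>2)"
  shows "(1 - st * sx - 2 * st * \<mu>) * (sx - st * sz * lift_series Qd) =
    sx - st * sz - st * sx\<^sup>2 - 2 * st\<^sup>2 * axis_series + st\<^sup>2 * origin_series"
proof -
  define x z t where "x = sx" and "z = sz" and "t = st"
  define s where "s = 1 - t * x - 2 * t * \<mu>"
  have "s * (- (z * lift_series Qd)) =
      - z - 2 * (t * axis_series) + t * origin_series + 2 * x * \<mu>"
    using kernel_method[OF mu] unfolding orbit_row_0 s_def x_def z_def t_def .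
  then have "t * (s * (- (z * lift_series Qd))) =
      t * (- z - 2 * (t * axis_series) + t * origin_series + 2 * x * \<mu>)" by simp
  then have "s * (x - t * z * lift_series Qd) =
      t * (- z - 2 * (t * axis_series) + t * origin_series + 2 * x * \<mu>) + s * x"
    by (simp add: algebra_simps)
  also have "\<dots> = x - t * z - t * x\<^sup>2 - 2 * t\<^sup>2 * axis_series + t\<^sup>2 * origin_series"
    unfolding s_def by (simp add: algebra_simps power2_eq_square)
  finally show ?thesis unfolding s_def x_def z_def t_def .
qed

section \<open>Fixed points of causal maps on power series\<close>

text \<open>
  A map \<open>\<Phi>\<close> is causal if the coefficients of \<open>\<Phi> F\<close> up to order \<open>n\<close> depend only on those of \<open>F\<close> up to
  order \<open>n\<close>. The fixed point of \<open>F = X \<Phi> F\<close> is then the coefficientwise limit of the iterates from 0.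
\<close>

lemma fps_fixpoint_ex1:
  fixes \<Phi> :: "'a :: comm_semiring_1 fps \<Rightarrow> 'a fps"
  assumes causal: "\<And>F G n. \<forall>i\<le>n. F $ i = G $ i \<Longrightarrow> \<Phi> F $ n = \<Phi> G $ n"
  shows "\<exists>!F. F = fps_X * \<Phi> F"
proof (rule ex_ex1I)
  define I where "I n = ((\<lambda>F. fps_X * \<Phi> F) ^^ n) 0" for n
  have I_Suc: "I (Suc n) = fps_X * \<Phi> (I n)" for n by (simp add: I_def)
  have step: "\<forall>i<n. I (Suc n) $ i = I n $ i" for n
  proof (induction n)
    case (Suc n)
    show ?case
    proof (intro allI impI)
      fix i assume "i < Suc n"
      then show "I (Suc (Suc n)) $ i = I (Suc n) $ i"
      proof (cases i)
        case 0
        then show ?thesis by (simp add: I_Suc)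
      next
        case (Suc l)
        have "\<Phi> (I (Suc n)) $ l = \<Phi> (I n) $ l"
          using Suc.IH \<open>i < Suc n\<close> \<open>i = Suc l\<close> by (intro causal) auto
        then show ?thesis using \<open>i = Suc l\<close> by (simp only: I_Suc fps_X_mult_nth) simp
      qed
    qed
  qed simp
  have stable: "I (Suc n + k) $ n = I (Suc n) $ n" for n k
    by (induction k) (use step in \<open>simp_all\<close>)
  define F where "F = Abs_fps (\<lambda>n. I (Suc n) $ n)"
  have F: "F $ i = I (Suc n) $ i" if "i \<le> n" for i n
    using stable[of i "n - i"] that by (simp add: F_def)
  have "F = fps_X * \<Phi> F"
  proof (rule fps_ext)
    fix n
    show "F $ n = (fps_X * \<Phi> F) $ n"
    proof (cases n)
      case 0
      then show ?thesis by (simp add: F_def I_Suc)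
    next
      case (Suc m)
      have "\<Phi> F $ m = \<Phi> (I (Suc m)) $ m" by (rule causal) (simp add: F)
      then show ?thesis by (simp add: Suc F_def I_Suc[of "Suc m"])
    qed
  qed
  then show "\<exists>F. F = fps_X * \<Phi> F" by blast
next
  fix F G assume F: "F = fps_X * \<Phi> F" and G: "G = fps_X * \<Phi> G"
  have "F $ n = G $ n" for n
  proof (induction n rule: less_induct)
    case (less n)
    show ?case
    proof (cases n)
      case 0
      then show ?thesis by (subst F, subst G) simp
    next
      case (Suc m)
      have "\<Phi> F $ m = \<Phi> G $ m" by (rule causal) (use less Suc in auto)
      then show ?thesis by (subst F, subst G) (simp add: Suc)
    qed
  qed
  then show "F = G" by (rule fps_ext)
qed

lemma fps_mult_nth_cong:
  fixes F G :: "'a :: comm_semiring_1 fps"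
  assumes "\<forall>i\<le>n. F $ i = F' $ i" "\<forall>i\<le>n. G $ i = G' $ i"
  shows "(F * G) $ n = (F' * G') $ n"
  using assms by (auto simp: fps_mult_nth intro!: sum.cong)

lemma kernel_root_exists: "\<exists>\<mu>. \<mu> = st * (sz + sx * \<mu> + \<mu>\<^sup>2)"
proof -
  have "\<exists>!\<mu>. \<mu> = st * (sz + sx * \<mu> + \<mu>\<^sup>2)"
  proof (rule fps_fixpoint_ex1)
    fix F G :: "rat fls fps" and n
    assume eq: "\<forall>i\<le>n. F $ i = G $ i"
    then have "(F * F) $ n = (G * G) $ n" "(sx * F) $ n = (sx * G) $ n"
      by (auto intro!: fps_mult_nth_cong)
    then show "(sz + sx * F + F\<^sup>2) $ n = (sz + sx * G + G\<^sup>2) $ n"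
      by (simp add: power2_eq_square)
  qed
  then show ?thesis by blast
qed

section \<open>The cubic series and its powers\<close>

lemma cubic_series_ex1: "\<exists>!U :: rat fps. U = fps_X * (2 + U ^ 3)"
proof (rule fps_fixpoint_ex1)
  fix F G :: "rat fps" and n
  assume eq: "\<forall>i\<le>n. F $ i = G $ i"
  then have "\<forall>i\<le>n. (F * F) $ i = (G * G) $ i"
    by (auto intro!: fps_mult_nth_cong)
  with eq have "(F * (F * F)) $ n = (G * (G * G)) $ n"
    by (intro fps_mult_nth_cong)
  then show "(2 + F ^ 3) $ n = (2 + G ^ 3) $ n"
    by (simp add: power3_eq_cube mult.assoc)
qed

lemma cubic_series_power_rec:
  fixes U :: "rat fps"
  assumes U: "U = fps_X * (2 + U ^ 3)"
  shows "(U ^ Suc p) $ Suc M = 2 * (U ^ p) $ M + (U ^ (p + 3)) $ M"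
proof -
  have "U ^ Suc p = fps_X * (2 * U ^ p + U ^ (p + 3))"
    by (subst power_Suc, subst U) (simp add: algebra_simps power_add)
  then show ?thesis by (simp add: fps_numeral_nth numeral_fps_const)
qed

lemma cubic_series_power_low:
  fixes U :: "rat fps"
  assumes U: "U = fps_X * (2 + U ^ 3)" and "M < p"
  shows "(U ^ p) $ M = 0"
proof -
  have "U $ 0 = 0" by (subst U) simp
  then show ?thesis using \<open>M < p\<close> by (simp add: startsby_zero_power_prefix)
qed

text \<open>
  The instance of Lagrange inversion for \<open>U = t (2 + U\<^sup>3)\<close>, multiplied out so that it also holds for
  \<open>p = q = 0\<close>. It follows by induction from \<open>U\<^sup>p\<^sup>+\<^sup>1 = t (2 U\<^sup>p + U\<^sup>p\<^sup>+\<^sup>3)\<close>.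
\<close>

lemma cubic_series_power_nth:
  fixes U :: "rat fps"
  assumes U: "U = fps_X * (2 + U ^ 3)"
  shows "of_nat (p + 3 * q) * (U ^ p) $ (p + 3 * q) =
    of_nat p * of_nat ((p + 3 * q) choose q) * 2 ^ (p + 2 * q)"
proof (induction "p + 3 * q" arbitrary: p q)
  case 0
  then show ?case by simp
next
  case (Suc M)
  show ?case
  proof (cases p)
    case 0
    then show ?thesis by (simp add: fps_one_nth)
  next
    case (Suc r)
    then have M: "M = r + 3 * q" "p + 3 * q = Suc M" using Suc.hyps by simp_all
    have rec: "(U ^ p) $ Suc M = 2 * (U ^ r) $ M + (U ^ (r + 3)) $ M"
      using cubic_series_power_rec[OF U] Suc by simp
    have 1: "of_nat M * (U ^ r) $ M = of_nat r * of_nat (M choose q) * 2 ^ (r + 2 * q)"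
      using Suc.hyps(1)[of r q] M by simp
    show ?thesis
    proof (cases "M = 0")
      case True
      then show ?thesis using M Suc rec cubic_series_power_low[OF U, of 0 3] by simp
    next
      case False
      have 2: "of_nat M * (U ^ (r + 3)) $ M * of_nat (Suc M) =
          of_nat (r + 3) * of_nat q * of_nat (Suc M choose q) * 2 ^ (Suc r + 2 * q)"
      proof (cases q)
        case 0
        then show ?thesis using M cubic_series_power_low[OF U, of M "r + 3"] by simp
      next
        case (Suc k)
        then have L: "of_nat M * (U ^ (r + 3)) $ M =
            of_nat (r + 3) * of_nat (M choose k) * 2 ^ (Suc r + 2 * q)"
          using Suc.hyps(1)[of "r + 3" k] M by (simp add: eval_nat_numeral)
        have C: "of_nat (Suc M) * of_nat (M choose k) = (of_nat q * of_nat (Suc M choose q) :: rat)"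
          using Suc_times_binomial[of k M] Suc by (metis of_nat_mult)
        have "of_nat M * (U ^ (r + 3)) $ M * of_nat (Suc M) =
            of_nat (r + 3) * (of_nat (Suc M) * of_nat (M choose k)) * 2 ^ (Suc r + 2 * q)"
          unfolding L by (simp only: ac_simps)
        then show ?thesis unfolding C by (simp only: ac_simps)
      qed
      have "(Suc M - q) * (Suc M choose q) = Suc M * (M choose q)"
        using binomial_absorb_comp[of "Suc M" q] by simp
      then have 3: "of_nat (Suc M) * of_nat (M choose q) =
          (of_nat (Suc M - q) * of_nat (Suc M choose q) :: rat)"
        by (metis of_nat_mult)
      define C :: rat where "C = of_nat (Suc M choose q)"
      define c :: rat where "c = of_nat (M choose q)"
      define a b where "a = (U ^ r) $ M" and "b = (U ^ (r + 3)) $ M"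
      define R Q e :: rat where "R = of_nat r" and "Q = of_nat q" and "e = 2 ^ (r + 2 * q)"
      have N: "of_nat (Suc M) = R + 3 * Q + 1" "of_nat M = R + 3 * Q"
        "of_nat (Suc M - q) = R + 2 * Q + 1" "of_nat p = R + 1"
        using M Suc by (simp_all add: R_def Q_def)
      have e2: "2 ^ (Suc r + 2 * q) = 2 * e" by (simp add: e_def)
      have i1: "(R + 3 * Q) * a = R * c * e"
        using 1 by (simp only: N a_def R_def[symmetric] c_def[symmetric] e_def[symmetric])
      have i2: "(R + 3 * Q) * b * (R + 3 * Q + 1) = (R + 3) * Q * C * (2 * e)"
        using 2 unfolding e2 N b_def[symmetric] C_def[symmetric] Q_def[symmetric]
        by (simp add: R_def)
      have i3: "(R + 3 * Q + 1) * c = (R + 2 * Q + 1) * C"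
        using 3 unfolding N c_def[symmetric] C_def[symmetric] .
      have nz: "R + 3 * Q \<noteq> 0" using False N by (metis of_nat_eq_0_iff)
      have "(R + 3 * Q) * ((R + 3 * Q + 1) * (2 * a + b)) =
          (R + 3 * Q) * ((R + 1) * C * (2 * e))"
        using i1 i2 i3 by algebra
      then have "(R + 3 * Q + 1) * (2 * a + b) = (R + 1) * C * (2 * e)"
        using nz by simp
      then show ?thesis
        unfolding M(2) rec N a_def[symmetric] b_def[symmetric] C_def[symmetric]
        using Suc e2 by (simp only:)
    qed
  qed
qed

section \<open>Square roots and exchange of the variables\<close>

text \<open>
  The coefficient of \<open>y\<^sup>a\<close> in \<open>(1 - y)\<^sup>-\<^sup>1\<^sup>/\<^sup>2\<close>.
\<close>

definition sqrt_coeff :: "nat \<Rightarrow> rat" where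
  "sqrt_coeff a = pochhammer (1 / 2) a / fact a"

lemma sqrt_coeff_Suc: "sqrt_coeff (Suc a) = sqrt_coeff a * (2 * of_nat a + 1) / (2 * of_nat a + 2)"
  by (simp add: sqrt_coeff_def pochhammer_Suc field_simps)

lemma sqrt_coeff_convolution: "(\<Sum>i=0..n. sqrt_coeff i * sqrt_coeff (n - i)) = 1"
proof -
  have "fact n = (\<Sum>k\<le>n. of_nat (n choose k) * pochhammer (1 / 2) k * pochhammer (1 / 2 :: rat) (n - k))"
    using pochhammer_binomial_sum[of "1 / 2 :: rat" "1 / 2" n] by (simp add: pochhammer_fact)
  also have "\<dots> = (\<Sum>k\<le>n. fact n * (sqrt_coeff k * sqrt_coeff (n - k)))"
    by (intro sum.cong refl) (simp add: sqrt_coeff_def binomial_fact)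
  finally show ?thesis by (simp add: sum_distrib_left[symmetric] atLeast0AtMost)
qed

lemma fps_const_sum: "fps_const (\<Sum>i\<in>A. f i) = (\<Sum>i\<in>A. fps_const (f i))"
  by (rule fps_ext) (simp add: fps_sum_nth fps_nth_fps_const)

text \<open>
  The inverse square root and the square root of \<open>1 - x U\<^sup>2\<close>, written with \<open>x\<close> as the outer variable and
  \<open>t\<close> as the inner one: in this order their coefficients are multiples of powers of \<open>U\<close>.
\<close>

definition inv_sqrt_series :: "rat fps \<Rightarrow> rat fps fps" where
  "inv_sqrt_series U = Abs_fps (\<lambda>a. fps_const (sqrt_coeff a) * U ^ (2 * a))"

definition sqrt_series :: "rat fps \<Rightarrow> rat fps fps" where
  "sqrt_series U = (1 - fps_X * fps_const (U\<^sup>2)) * inv_sqrt_series U"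

lemma inv_sqrt_series_square:
  "(1 - fps_X * fps_const (U\<^sup>2)) * (inv_sqrt_series U)\<^sup>2 = 1"
proof -
  have "(inv_sqrt_series U)\<^sup>2 = Abs_fps (\<lambda>n. U ^ (2 * n))"
  proof (rule fps_ext)
    fix n
    have "(inv_sqrt_series U)\<^sup>2 $ n =
        (\<Sum>i=0..n. fps_const (sqrt_coeff i * sqrt_coeff (n - i)) * U ^ (2 * n))"
      unfolding power2_eq_square fps_mult_nth
    proof (rule sum.cong[OF refl])
      fix i assume "i \<in> {0..n}"
      then have "U ^ (2 * n) = U ^ (2 * i) * U ^ (2 * (n - i))"
        by (simp flip: power_add distrib_left)
      then show "inv_sqrt_series U $ i * inv_sqrt_series U $ (n - i) =
          fps_const (sqrt_coeff i * sqrt_coeff (n - i)) * U ^ (2 * n)"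
        by (simp add: inv_sqrt_series_def ac_simps flip: fps_const_mult)
    qed
    also have "\<dots> = fps_const (\<Sum>i=0..n. sqrt_coeff i * sqrt_coeff (n - i)) * U ^ (2 * n)"
      by (simp add: sum_distrib_right[symmetric] fps_const_sum)
    finally show "(inv_sqrt_series U)\<^sup>2 $ n = Abs_fps (\<lambda>n. U ^ (2 * n)) $ n"
      by (simp add: sqrt_coeff_convolution)
  qed
  moreover have "(1 - fps_X * fps_const (U\<^sup>2)) * Abs_fps (\<lambda>n. U ^ (2 * n)) = 1"
  proof (rule fps_ext)
    fix n
    show "((1 - fps_X * fps_const (U\<^sup>2)) * Abs_fps (\<lambda>n. U ^ (2 * n))) $ n = 1 $ n"
      by (cases n) (simp_all add: left_diff_distrib mult.assoc power2_eq_square)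
  qed
  ultimately show ?thesis by simp
qed

lemma sqrt_series_times_inv: "sqrt_series U * inv_sqrt_series U = 1"
  using inv_sqrt_series_square[of U] by (simp add: sqrt_series_def power2_eq_square mult.assoc)

lemma sqrt_series_square: "(sqrt_series U)\<^sup>2 = 1 - fps_X * fps_const (U\<^sup>2)"
proof -
  have "(sqrt_series U)\<^sup>2 = (1 - fps_X * fps_const (U\<^sup>2)) *
      ((1 - fps_X * fps_const (U\<^sup>2)) * (inv_sqrt_series U)\<^sup>2)"
    by (simp only: sqrt_series_def power2_eq_square ac_simps)
  then show ?thesis unfolding inv_sqrt_series_square by simp
qed

lemma sqrt_series_low: "sqrt_series U $ 0 = 1" "2 * sqrt_series U $ Suc 0 = - (U\<^sup>2)"
proof -
  show "sqrt_series U $ 0 = 1"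
    by (simp add: sqrt_series_def inv_sqrt_series_def sqrt_coeff_def)
  have "sqrt_series U $ Suc 0 = fps_const (1 / 2) * U\<^sup>2 - U\<^sup>2"
    by (simp add: sqrt_series_def inv_sqrt_series_def sqrt_coeff_def left_diff_distrib mult.assoc)
  moreover have "2 * (fps_const (1 / 2) * U\<^sup>2) = U\<^sup>2"
    by (simp add: numeral_fps_const)
  ultimately show "2 * sqrt_series U $ Suc 0 = - (U\<^sup>2)"
    by (simp add: right_diff_distrib)
qed

text \<open>
  The exchange of the two variables, an involutive ring automorphism.
\<close>

definition swap_series :: "rat fps fps \<Rightarrow> rat fps fps" where
  "swap_series F = Abs_fps (\<lambda>a. Abs_fps (\<lambda>m. F $ m $ a))"

lemma swap_series_nth: "swap_series F $ a $ m = F $ m $ a"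
  by (simp add: swap_series_def)

lemma swap_series_swap [simp]: "swap_series (swap_series F) = F"
  by (intro fps_ext) (simp add: swap_series_nth)

lemma swap_series_add: "swap_series (F + G) = swap_series F + swap_series G"
  by (intro fps_ext) (simp add: swap_series_nth)

lemma swap_series_diff: "swap_series (F - G) = swap_series F - swap_series G"
  by (intro fps_ext) (simp add: swap_series_nth)

lemma swap_series_mult: "swap_series (F * G) = swap_series F * swap_series G"
proof (intro fps_ext)
  fix a m
  have "swap_series (F * G) $ a $ m = (\<Sum>i=0..m. \<Sum>j=0..a. F $ i $ j * G $ (m - i) $ (a - j))"
    by (simp add: swap_series_nth fps_mult_nth fps_sum_nth)
  also have "\<dots> = (\<Sum>j=0..a. \<Sum>i=0..m. F $ i $ j * G $ (m - i) $ (a - j))"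
    by (rule sum.swap)
  also have "\<dots> = (swap_series F * swap_series G) $ a $ m"
    by (simp add: swap_series_nth fps_mult_nth fps_sum_nth)
  finally show "swap_series (F * G) $ a $ m = (swap_series F * swap_series G) $ a $ m" .
qed

lemma swap_series_1: "swap_series 1 = 1"
  by (intro fps_ext) (simp add: swap_series_nth fps_one_nth)

lemma swap_series_power: "swap_series (F ^ n) = swap_series F ^ n"
  by (induction n) (simp_all add: swap_series_1 swap_series_mult)

lemma swap_series_numeral: "swap_series (numeral k) = numeral k"
  by (induction k) (simp_all only: numeral.simps swap_series_1 swap_series_add)

lemma swap_series_x: "swap_series ser_x = fps_X"
  by (intro fps_ext) (simp add: swap_series_nth ser_x_def fps_X_nth fps_nth_fps_const)

lemma swap_series_t: "swap_series ser_t = fps_const fps_X"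
  by (intro fps_ext) (simp add: swap_series_nth ser_t_def fps_X_nth fps_nth_fps_const)

lemma swap_series_in_t: "swap_series (in_t U) = fps_const U"
  by (intro fps_ext) (simp add: swap_series_nth in_t_def fps_nth_fps_const)

lemmas swap_series_simps = swap_series_add swap_series_diff swap_series_mult swap_series_1
  swap_series_power swap_series_numeral swap_series_x swap_series_t swap_series_in_t

lemma swap_series_eq_iff: "swap_series F = swap_series G \<longleftrightarrow> F = G"
  by (metis swap_series_swap)

lemma in_t_equation:
  assumes "U = fps_X * (2 + U ^ 3)"
  shows "in_t U = ser_t * (2 + in_t U ^ 3)"
proof -
  have "swap_series (in_t U) = swap_series (ser_t * (2 + in_t U ^ 3))"
    unfolding swap_series_simps
    by (subst assms) (simp add: numeral_fps_const)
  then show ?thesis unfolding swap_series_eq_iff .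
qed

lemma fps_fps_sqrt_unique:
  fixes F G :: "rat fps fps"
  assumes "F\<^sup>2 = G\<^sup>2" "F $ 0 $ 0 = 1" "G $ 0 $ 0 = 1"
  shows "F = G"
proof -
  have "(F + G) $ 0 $ 0 \<noteq> 0" using assms by simp
  then have "F + G \<noteq> 0" by (metis fps_zero_nth)
  then show ?thesis using assms(1) by (auto simp: power2_eq_iff)
qed

lemma ser_sqrt_eq: "ser_sqrt (1 - ser_x * (in_t U)\<^sup>2) = swap_series (sqrt_series U)"
proof -
  have sq: "(swap_series (sqrt_series U))\<^sup>2 = 1 - ser_x * (in_t U)\<^sup>2"
    unfolding swap_series_eq_iff[symmetric, of _ "1 - ser_x * (in_t U)\<^sup>2"]
    by (simp add: swap_series_simps sqrt_series_square)
  have one: "swap_series (sqrt_series U) $ 0 $ 0 = 1"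
    by (simp add: swap_series_nth sqrt_series_low)
  show ?thesis unfolding ser_sqrt_def
    by (rule the_equality) (use sq one fps_fps_sqrt_unique in auto)
qed

section \<open>Separation of positive and negative exponents\<close>

text \<open>
  All exponents of \<open>z\<close> are at most \<open>d\<close>; equivalently, all exponents of \<open>x\<close> are at least \<open>-d\<close>.
\<close>

definition z_degree_le :: "int \<Rightarrow> rat fls fps \<Rightarrow> bool" where
  "z_degree_le d F \<longleftrightarrow> (\<forall>m n. n > d \<longrightarrow> F $ m $$ n = 0)"

lemma z_degree_le_mono: "z_degree_le d F \<Longrightarrow> d \<le> e \<Longrightarrow> z_degree_le e F"
  by (simp add: z_degree_le_def)

lemma z_degree_le_add: "z_degree_le d F \<Longrightarrow> z_degree_le d G \<Longrightarrow> z_degree_le d (F + G)"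
  by (simp add: z_degree_le_def)

lemma z_degree_le_diff: "z_degree_le d F \<Longrightarrow> z_degree_le d G \<Longrightarrow> z_degree_le d (F - G)"
  by (simp add: z_degree_le_def)

lemma fls_mult_nth_eq_0:
  fixes f g :: "rat fls"
  assumes "\<forall>k>d. f $$ k = 0" "\<forall>k>e. g $$ k = 0" "n > d + e"
  shows "(f * g) $$ n = 0"
  unfolding fls_times_nth(2)
proof (rule sum.neutral, rule ballI)
  fix i
  have "i > d \<or> n - i > e" using assms(3) by linarith
  then show "f $$ i * g $$ (n - i) = 0" using assms(1,2) by auto
qed

lemma fls_sum_nth: "(\<Sum>i\<in>A. f i) $$ n = (\<Sum>i\<in>A. f i $$ n)"
  by (induction A rule: infinite_finite_induct) simp_all

lemma z_degree_le_mult: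
  assumes "z_degree_le d F" "z_degree_le e G"
  shows "z_degree_le (d + e) (F * G)"
  unfolding z_degree_le_def fps_mult_nth fls_sum_nth
  using assms by (auto simp: z_degree_le_def intro!: sum.neutral fls_mult_nth_eq_0)

lemma z_degree_le_0_power: "z_degree_le 0 F \<Longrightarrow> z_degree_le 0 (F ^ k)"
proof (induction k)
  case 0
  show ?case by (auto simp: z_degree_le_def fps_one_nth)
next
  case (Suc k)
  then show ?case using z_degree_le_mult[of 0 F 0 "F ^ k"] by simp
qed

text \<open>
  Division by \<open>1 + G\<close>, where \<open>G\<close> has no constant term in \<open>t\<close> and no positive powers of \<open>z\<close>,
  preserves bounds on the degree. A similar coefficientwise induction transfers a bound \<open>d \<le> 0\<close>
  from \<open>(1 + G)\<^sup>2 - 1\<close> to \<open>G\<close>.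
\<close>

lemma z_degree_le_cancel:
  assumes H: "z_degree_le d (F + G * F)" and G: "z_degree_le 0 G" "G $ 0 = 0"
  shows "z_degree_le d F"
proof -
  have "\<forall>n>d. F $ m $$ n = 0" for m
  proof (induction m rule: less_induct)
    case (less m)
    have "(G * F) $ m $$ n = 0" if "n > d" for n
      unfolding fps_mult_nth fls_sum_nth
    proof (rule sum.neutral, rule ballI)
      fix i assume "i \<in> {0..m}"
      then consider "i = 0" | "m - i < m" by fastforce
      then show "(G $ i * F $ (m - i)) $$ n = 0"
      proof cases
        case 2
        then show ?thesis using less G(1) that
          by (intro fls_mult_nth_eq_0[of 0 _ d]) (auto simp: z_degree_le_def)
      qed (simp add: G)
    qed
    then show ?case using H
      unfolding z_degree_le_def fps_add_nth fls_plus_nth by (metis add_0_right)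
  qed
  then show ?thesis by (simp add: z_degree_le_def)
qed

lemma z_degree_le_sqrt:
  assumes H: "z_degree_le d (2 * G + G\<^sup>2)" and "d \<le> 0" and "G $ 0 = 0"
  shows "z_degree_le d G"
proof -
  have "\<forall>n>d. G $ m $$ n = 0" for m
  proof (induction m rule: less_induct)
    case (less m)
    have "(G * G) $ m $$ n = 0" if "n > d" for n
      unfolding fps_mult_nth fls_sum_nth
    proof (rule sum.neutral, rule ballI)
      fix i assume "i \<in> {0..m}"
      then consider "i = 0" | "i = m" | "i < m" "m - i < m" by fastforce
      then show "(G $ i * G $ (m - i)) $$ n = 0"
      proof cases
        case 3
        then show ?thesis using less \<open>d \<le> 0\<close> that
          by (intro fls_mult_nth_eq_0[of d _ d]) auto
      qed (simp_all add: assms)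
    qed
    then have "2 * (G $ m $$ n) = 0" if "n > d" for n using H that
      unfolding z_degree_le_def fps_add_nth fls_plus_nth power2_eq_square two_mult_nth
      by (metis add_0_right)
    then show ?case by simp
  qed
  then show ?thesis by (simp add: z_degree_le_def)
qed

lemma z_degree_le_x: "z_degree_le (-1) sx"
  by (auto simp: z_degree_le_def fps_nth_fps_const)

lemma z_degree_le_z: "z_degree_le 1 sz"
  by (auto simp: z_degree_le_def fps_nth_fps_const)

lemma z_degree_le_t: "z_degree_le 0 st"
  by (auto simp: z_degree_le_def fps_X_nth)

lemma z_degree_le_const: "z_degree_le 0 (fps_const (fls_const c))"
  by (auto simp: z_degree_le_def fps_nth_fps_const)

lemma z_degree_le_1: "z_degree_le 0 1"
  by (auto simp: z_degree_le_def fps_one_nth)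

lemma z_degree_le_axis: "z_degree_le 0 axis_series"
  by (auto simp: z_degree_le_def axis_series_nth walk_count_outside)

lemma z_degree_le_origin: "z_degree_le 0 origin_series"
  by (auto simp: z_degree_le_def origin_series_def)

lemma z_degree_le_in_t: "z_degree_le 0 (lift_series (in_t U))"
  by (auto simp: z_degree_le_def lift_series_nth in_t_def fps_nth_fps_const)

lemma z_degree_le_0_mult: "z_degree_le 0 F \<Longrightarrow> z_degree_le 0 G \<Longrightarrow> z_degree_le 0 (F * G)"
  using z_degree_le_mult[of 0 F 0 G] by simp

lemma z_degree_le_numeral: "z_degree_le 0 (numeral k)"
  by (induction k) (simp_all only: numeral.simps z_degree_le_1 z_degree_le_add)

lemmas z_degree_le_0_intros = z_degree_le_add z_degree_le_diff z_degree_le_0_mult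
  z_degree_le_0_power z_degree_le_numeral z_degree_le_1 z_degree_le_t z_degree_le_axis
  z_degree_le_origin z_degree_le_in_t z_degree_le_const
  z_degree_le_mono[OF z_degree_le_x, of 0, simplified]

lemma lift_series_numeral: "lift_series (numeral k) = numeral k"
  by (induction k) (simp_all only: numeral.simps lift_series_1 lift_series_add)

lemmas lift_series_simps = lift_series_add lift_series_diff lift_series_mult lift_series_1
  lift_series_power lift_series_numeral lift_series_x lift_series_t

text \<open>
  The discriminant factors: \<open>s (2 + W\<^sup>3) = 2 p (1 + g)\<close>, where \<open>p\<^sup>2 = 1 - z W\<^sup>2\<close> and
  \<open>4 (1 + g)\<^sup>2 = 4 - W (W\<^sup>3 + 4) x + W\<^sup>2 x\<^sup>2\<close>, so that \<open>g\<close> involves only negative powers of \<open>z\<close>. The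
  factor \<open>p\<close> stays with the diagonal, and division by \<open>1 + g\<close> keeps the exponents of \<open>z\<close> on the other
  side bounded above. The subtracted terms \<open>2 x - W\<^sup>2 - z W\<close> are those of \<open>2 p (x - t z Q\<^sub>d)\<close> of exponent
  \<open>-1\<close>, \<open>0\<close> and \<open>1\<close> in \<open>z\<close>.
\<close>

lemma factor_separation:
  fixes U :: "rat fps"
  assumes U: "U = fps_X * (2 + U ^ 3)"
  defines "W \<equiv> lift_series (in_t U)" and "p \<equiv> lift_series (swap_series (sqrt_series U))"
  shows "z_degree_le 0 (2 * p * (sx - st * sz * lift_series Qd) - (2 * sx - W\<^sup>2 - sz * W))"
proof -
  define x z t where "x = sx" and "z = sz" and "t = st"
  define h where "h = (fps_const (fls_const (1 / 2)) :: rat fls fps)"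
  have h: "2 * h = 1"
    unfolding mult_2 by (rule fps_ext, rule fls_eqI) (simp add: h_def)
  have xz: "x * z = 1" unfolding x_def z_def by (rule sx_sz)
  have W: "W = t * (2 + W ^ 3)"
    using arg_cong[OF in_t_equation[OF U], of lift_series]
    unfolding lift_series_simps W_def t_def .
  have "(swap_series (sqrt_series U))\<^sup>2 = 1 - ser_x * (in_t U)\<^sup>2"
    unfolding swap_series_eq_iff[symmetric, of _ "1 - ser_x * (in_t U)\<^sup>2"]
    by (simp add: swap_series_simps sqrt_series_square)
  then have p2: "p\<^sup>2 = 1 - z * W\<^sup>2"
    unfolding p_def W_def z_def lift_series_power[symmetric] by (simp add: lift_series_simps)
  have W0: "W $ 0 = 0" by (subst W) (simp add: t_def)
  have p0: "p $ 0 = 1"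
  proof -
    have "(p $ 0)\<^sup>2 = 1"
      using arg_cong[OF p2, of "\<lambda>F. F $ 0"] W0 by (simp add: power2_eq_square)
    moreover have "p $ 0 \<noteq> -1"
    proof
      assume "p $ 0 = -1"
      then have "p $ 0 $$ 0 = -1" by simp
      then show False by (simp add: p_def lift_series_nth swap_series_nth sqrt_series_low)
    qed
    ultimately show ?thesis by (simp add: power2_eq_1_iff)
  qed
  obtain B where B: "B * p = 1" using inverse_mult_eq_1[of p] p0 by auto
  have "(B * p) $ 0 = 1" unfolding B by simp
  then have B0: "B $ 0 = 1" using p0 by simp
  obtain \<mu> where mu: "\<mu> = t * (z + x * \<mu> + \<mu>\<^sup>2)"
    using kernel_root_exists unfolding x_def z_def t_def by blast
  define s where "s = 1 - t * x - 2 * t * \<mu>"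
  define R where "R = x - t * z - t * x\<^sup>2 - 2 * t\<^sup>2 * axis_series + t\<^sup>2 * origin_series"
  define L where "L = x - t * z * lift_series Qd"
  have sL: "s * L = R"
    unfolding s_def L_def R_def x_def z_def t_def
    using separated_equation mu unfolding x_def z_def t_def by blast
  have s2: "s\<^sup>2 = (1 - t * x)\<^sup>2 - 4 * t\<^sup>2 * z"
    using mu unfolding s_def by algebra
  \<comment> \<open>The quotient of \<open>s (2 + W\<^sup>3) / 2\<close> by \<open>p\<close> is \<open>1 + g\<close>.\<close>
  define g where "g = h * s * (2 + W ^ 3) * B - 1"
  have g: "(1 + g) * (2 * p) = s * (2 + W ^ 3)"
    using h B unfolding g_def by algebra
  have g0: "g $ 0 = 0"
    using B0 W0 arg_cong[OF h, of "\<lambda>F. F $ 0"]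
    by (simp add: g_def s_def t_def h_def numeral_fps_const power3_eq_cube
        mult.commute[of "fls_const (1 / 2)" 2])
  have "s\<^sup>2 * (2 + W ^ 3)\<^sup>2 = p\<^sup>2 * (4 - W * (W ^ 3 + 4) * x + W\<^sup>2 * x\<^sup>2)"
    using W xz unfolding s2 p2 by algebra
  then have "4 * (2 * g + g\<^sup>2) = W\<^sup>2 * x\<^sup>2 - W * (W ^ 3 + 4) * x"
    using g B by algebra
  then have "2 * g + g\<^sup>2 = (h * h * (W * (W * x - (W ^ 3 + 4)))) * x"
    using h by algebra
  moreover have "z_degree_le 0 (h * h * (W * (W * x - (W ^ 3 + 4))))"
    unfolding x_def h_def W_def by (intro z_degree_le_0_intros)
  then have "z_degree_le (-1) (h * h * (W * (W * x - (W ^ 3 + 4))) * x)"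
    unfolding x_def using z_degree_le_mult[OF _ z_degree_le_x] by fastforce
  ultimately have "z_degree_le (-1) (2 * g + g\<^sup>2)" by (simp only:)
  then have dg: "z_degree_le (-1) g"
    by (rule z_degree_le_sqrt) (simp_all add: g0)
  define T where "T = 2 * x - W\<^sup>2 - z * W"
  have "z_degree_le 1 T"
    unfolding T_def x_def W_def z_def
    by (intro z_degree_le_diff z_degree_le_mono[of 0 _ 1] z_degree_le_0_intros
        z_degree_le_mult[OF z_degree_le_z, of 0, simplified]) simp_all
  then have dgT: "z_degree_le 0 (g * T)"
    using z_degree_le_mult[OF dg] by fastforce
  define E where "E = 2 * p * L - T"
  \<comment> \<open>The only term of positive degree in \<open>(2 + W\<^sup>3) R\<close>, namely \<open>- (2 + W\<^sup>3) t z = - z W\<close>, cancels.\<close>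
  have "E + g * E = (2 + W ^ 3) * (x - t * x\<^sup>2 - 2 * t\<^sup>2 * axis_series + t\<^sup>2 * origin_series)
      - (2 * x - W\<^sup>2) - g * T"
    using g sL W unfolding E_def T_def R_def by algebra
  moreover have "z_degree_le 0 \<dots>"
    unfolding x_def t_def W_def
    by (intro z_degree_le_diff[OF _ dgT[unfolded x_def W_def]] z_degree_le_0_intros)
  ultimately have "z_degree_le 0 E"
    using z_degree_le_cancel[of 0 E g] z_degree_le_mono[OF dg, of 0] g0 by simp
  then show ?thesis unfolding E_def T_def L_def x_def z_def t_def .
qed

text \<open>
  The difference \<open>Y\<close> of the two sides vanishes: its coefficients of \<open>x\<^sup>0\<close> and \<open>x\<^sup>1\<close> are read off from the
  square root, and those of higher powers of \<open>x\<close> vanish by the bound just obtained.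
\<close>

lemma diagonal_equation:
  fixes U :: "rat fps"
  assumes U: "U = fps_X * (2 + U ^ 3)"
  shows "2 * (sqrt_series U * (1 - fps_const fps_X * fps_X\<^sup>2 * swap_series Qd)) =
    2 - fps_X * fps_const (U\<^sup>2) - fps_X\<^sup>2 * fps_const U"
proof -
  define Y where "Y = 2 * (swap_series (sqrt_series U) * (1 - ser_t * ser_x\<^sup>2 * Qd))
    - (2 - ser_x * (in_t U)\<^sup>2 - ser_x\<^sup>2 * in_t U)"
  have Y: "swap_series Y = 2 * (sqrt_series U * (1 - fps_const fps_X * fps_X\<^sup>2 * swap_series Qd))
    - (2 - fps_X * fps_const (U\<^sup>2) - fps_X\<^sup>2 * fps_const U)"
    by (simp add: Y_def swap_series_simps)
  have Y0: "swap_series Y $ 0 = 0"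
    unfolding Y by (simp add: sqrt_series_low numeral_fps_const power2_eq_square)
  have Y1: "swap_series Y $ Suc 0 = 0"
    using sqrt_series_low[of U]
    unfolding Y by (simp add: numeral_fps_const power2_eq_square right_diff_distrib mult.assoc)
  define E where "E = 2 * lift_series (swap_series (sqrt_series U)) *
    (sx - st * sz * lift_series Qd) - (2 * sx - (lift_series (in_t U))\<^sup>2 - sz * lift_series (in_t U))"
  have "lift_series Y = sz * E"
  proof -
    define x z where "x = sx" and "z = sz"
    have xz: "x * z = 1" unfolding x_def z_def by (rule sx_sz)
    show ?thesis
      unfolding Y_def E_def lift_series_simps x_def[symmetric] z_def[symmetric]
      using xz by algebra
  qed
  moreover have "z_degree_le 0 E" unfolding E_def by (rule factor_separation[OF U])
  ultimately have "lift_series Y $ m $$ n = 0" if "n > 1" for m n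
    using that by (simp add: z_degree_le_def sz_mult_nth del: fps_mult_left_const_nth)
  then have "Y $ m $ k = 0" if "k > 1" for m k
    using that[folded of_nat_less_iff[where 'a=int]] lift_series_nth[of Y m "int k"] by simp
  moreover have "Y $ m $ 0 = 0" "Y $ m $ Suc 0 = 0" for m
    using Y0 Y1 by (simp_all flip: swap_series_nth)
  ultimately have "Y $ m $ k = 0" for m k
    by (cases k; cases "k - 1") auto
  then have "swap_series Y = 0" by (intro fps_ext) (simp add: swap_series_nth)
  then show ?thesis unfolding Y by simp
qed

text \<open>
  Multiplication of the previous equation by the inverse square root gives \<open>2 t\<close> times the coefficient of \<open>x\<^sup>a\<close>
  in the diagonal series as a combination of two powers of \<open>U\<close>.
\<close>

lemma diagonal_coeff_series:
  fixes U :: "rat fps"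
  assumes U: "U = fps_X * (2 + U ^ 3)"
  shows "2 * fps_X * swap_series Qd $ a =
    fps_const (sqrt_coeff (Suc a) - 2 * sqrt_coeff (Suc (Suc a))) * U ^ (2 * a + 4) +
    fps_const (sqrt_coeff a) * U ^ (2 * a + 1)"
proof -
  define C where "C = inv_sqrt_series U"
  define S where "S = sqrt_series U"
  define c where "c = (fps_const fps_X :: rat fps fps)"
  have "S * C = 1" unfolding S_def C_def by (rule sqrt_series_times_inv)
  moreover have "2 * (S * (1 - c * fps_X\<^sup>2 * swap_series Qd)) =
    2 - fps_X * fps_const (U\<^sup>2) - fps_X\<^sup>2 * fps_const U"
    using diagonal_equation[OF U] unfolding S_def c_def .
  ultimately have "2 * (c * fps_X\<^sup>2 * swap_series Qd) =
      2 - 2 * C + fps_X * (fps_const (U\<^sup>2) * C) + fps_X\<^sup>2 * (fps_const U * C)"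
    by algebra
  then have "fps_X\<^sup>2 * (2 * c * swap_series Qd) =
      2 - 2 * C + fps_X * (fps_const (U\<^sup>2) * C) + fps_X\<^sup>2 * (fps_const U * C)"
    by algebra
  then have "(fps_X\<^sup>2 * (2 * c * swap_series Qd)) $ (a + 2) =
      (2 - 2 * C + fps_X * (fps_const (U\<^sup>2) * C) + fps_X\<^sup>2 * (fps_const U * C)) $ (a + 2)"
    by simp
  then have "2 * fps_X * swap_series Qd $ a = - (2 * C $ (a + 2)) + U\<^sup>2 * C $ (a + 1) + U * C $ a"
    by (simp add: fps_X_power_mult_nth c_def numeral_fps_const mult.assoc)
  then show ?thesis
    by (simp add: C_def inv_sqrt_series_def numeral_fps_const algebra_simps power_add
        eval_nat_numeral flip: fps_const_mult fps_const_sub)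
qed

section \<open>Closed form of the numbers on the diagonal\<close>

lemma sqrt_coeff_fact: "sqrt_coeff a * (4 ^ a * fact a ^ 2) = fact (2 * a)"
proof (induction a)
  case 0
  show ?case by (simp add: sqrt_coeff_def)
next
  case (Suc a)
  have "sqrt_coeff (Suc a) * (4 ^ Suc a * fact (Suc a) ^ 2) =
      (sqrt_coeff a * (4 ^ a * fact a ^ 2)) * ((2 * of_nat a + 1) * (2 * of_nat a + 2))"
    by (simp add: sqrt_coeff_Suc field_simps power2_eq_square)
  also have "\<dots> = fact (2 * Suc a)"
    unfolding Suc by (simp add: algebra_simps)
  finally show ?case .
qed

lemma rk_diagonal_binomial:
  "of_nat (rk (3 * q + 2 * a) a a) * (of_nat (3 * q + 2 * a + 1) * of_nat (q + a + 1)) =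
    sqrt_coeff a * (2 * of_nat a + 1) * (of_nat a + 1) * 4 ^ (q + a) *
    of_nat ((3 * q + 2 * a + 1) choose q)"
proof -
  obtain U :: "rat fps" where U: "U = fps_X * (2 + U ^ 3)"
    using cubic_series_ex1 by blast
  \<comment> \<open>The diagonal equation carries an extra factor \<open>t\<close>, so coefficients are taken at \<open>M\<close>, one more than the length.\<close>
  define M where "M = 3 * q + 2 * a + 1"
  define N Q A c e C :: rat where "N = of_nat M" and "Q = of_nat q" and "A = of_nat a"
    and "c = sqrt_coeff a" and "e = 2 ^ (2 * a + 2 * q)" and "C = of_nat (M choose q)"
  define r :: rat where "r = of_nat (rk (3 * q + 2 * a) a a)"
  define u v where "u = (U ^ (2 * a + 1)) $ M" and "v = (U ^ (2 * a + 4)) $ M"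
  have NQA: "N = 3 * Q + 2 * A + 1" by (simp add: N_def M_def Q_def A_def)
  have "(2 * fps_X * swap_series Qd $ a) $ M = 2 * r"
    by (simp add: M_def r_def numeral_fps_const mult.assoc swap_series_nth Qd_def)
  then have r: "2 * r = (sqrt_coeff (Suc a) - 2 * sqrt_coeff (Suc (Suc a))) * v + c * u"
    unfolding diagonal_coeff_series[OF U] by (simp add: u_def v_def c_def)
  have "sqrt_coeff (Suc a) - 2 * sqrt_coeff (Suc (Suc a)) = - c * (2 * A + 1) / (2 * (A + 2))"
  proof -
    have "2 * A + 2 \<noteq> 0" "2 * A + 4 \<noteq> 0" "A + 2 \<noteq> 0"
      using of_nat_0_le_iff[of a, where 'a=rat] unfolding A_def by linarith+
    then show ?thesis
      by (simp add: sqrt_coeff_Suc A_def[symmetric] c_def[symmetric] divide_simps) algebra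
  qed
  then have c2: "(sqrt_coeff (Suc a) - 2 * sqrt_coeff (Suc (Suc a))) * (2 * (A + 2)) = - c * (2 * A + 1)"
    using of_nat_0_le_iff[of a, where 'a=rat] by (simp add: A_def)
  have u: "N * u = (2 * A + 1) * C * (2 * e)"
  proof -
    have "M = (2 * a + 1) + 3 * q" by (simp add: M_def)
    then show ?thesis
      using cubic_series_power_nth[OF U, of "2 * a + 1" q]
      by (simp add: N_def u_def C_def e_def A_def)
  qed
  have v: "N * v * (Q + A + 1) = (A + 2) * Q * C * (4 * e)"
  proof (cases q)
    case 0
    then show ?thesis
      using cubic_series_power_low[OF U, of M "2 * a + 4"] by (simp add: v_def Q_def M_def)
  next
    case (Suc k)
    then have "M = (2 * a + 4) + 3 * k" by (simp add: M_def)
    then have "N * v = (2 * A + 4) * of_nat (M choose k) * (4 * e)"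
      using cubic_series_power_nth[OF U, of "2 * a + 4" k] Suc
      by (simp add: N_def v_def e_def A_def power_add)
    moreover have "Q * C = (2 * Q + 2 * A + 2) * of_nat (M choose k)"
    proof -
      have "Suc k * (M choose Suc k) = (M - k) * (M choose k)"
        by (metis binomial_absorption binomial_absorb_comp)
      moreover have "M - k = 2 * q + 2 * a + 2" using Suc by (simp add: M_def)
      ultimately have "(of_nat (q * (M choose q)) :: rat) = of_nat ((2 * q + 2 * a + 2) * (M choose k))"
        using Suc by simp
      then show ?thesis by (simp add: Q_def C_def A_def algebra_simps)
    qed
    ultimately show ?thesis by algebra
  qed
  have "A + 2 \<noteq> 0" using of_nat_0_le_iff[of a, where 'a=rat] unfolding A_def by linarith
  moreover have "(A + 2) * (r * (N * (Q + A + 1))) =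
      (A + 2) * (c * (2 * A + 1) * (A + 1) * e * C)"
    using r c2 u v by algebra
  ultimately have "r * (N * (Q + A + 1)) = c * (2 * A + 1) * (A + 1) * e * C" by simp
  moreover have "e = 4 ^ (q + a)"
    using power_mult[of "2 :: rat" 2 "q + a"] by (simp add: e_def add.commute)
  moreover have "of_nat (q + a + 1) = Q + A + 1" by (simp add: Q_def A_def)
  ultimately show ?thesis
    by (simp only: r_def[symmetric] M_def[symmetric] N_def[symmetric] A_def[symmetric]
        c_def[symmetric] C_def[symmetric])
qed

lemma rk_diagonal:
  assumes "a \<le> n"
  shows "of_nat (rk (3 * n - a) a a) =
    K n * (fact (a + 1) * fact (2 * a + 1) * fact n * fact (3 * n - a) /
      (4 ^ a * fact a ^ 3 * fact (n - a) * fact (3 * n)))"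
proof -
  define q where "q = n - a"
  have n: "n = a + q" using assms by (simp add: q_def)
  have m: "3 * n - a = 3 * q + 2 * a" using n by simp
  define M where "M = 3 * q + 2 * a"
  define r :: rat where "r = of_nat (rk M a a)"
  have C: "of_nat (Suc M choose q) * (fact q * fact (2 * n + 1)) = (of_nat (Suc M) * fact M :: rat)"
  proof -
    have "Suc M - q = 2 * n + 1" "q \<le> Suc M" using n by (simp_all add: M_def)
    then show ?thesis
      using binomial_fact[of q "Suc M", where 'a=rat] by simp
  qed
  have "r * (of_nat (Suc M) * of_nat (n + 1)) = sqrt_coeff a * (2 * of_nat a + 1) * (of_nat a + 1)
      * 4 ^ n * of_nat (Suc M choose q)"
    using rk_diagonal_binomial[of q a] by (simp add: r_def M_def n add.commute)
  then have "r * (of_nat (Suc M) * of_nat (n + 1)) * (fact q * fact (2 * n + 1)) =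
      sqrt_coeff a * (2 * of_nat a + 1) * (of_nat a + 1) * 4 ^ n * (of_nat (Suc M) * fact M)"
    unfolding C[symmetric] by (simp only: mult.assoc)
  then have "of_nat (Suc M) * (r * (of_nat (n + 1) * fact q * fact (2 * n + 1))) =
      of_nat (Suc M) * (sqrt_coeff a * (2 * of_nat a + 1) * (of_nat a + 1) * 4 ^ n * fact M)"
    by (simp only: ac_simps)
  then have "r * (of_nat (n + 1) * fact q * fact (2 * n + 1)) =
      sqrt_coeff a * (2 * of_nat a + 1) * (of_nat a + 1) * 4 ^ n * fact M"
    by (subst (asm) mult_left_cancel) (simp_all del: of_nat_Suc)
  moreover have "sqrt_coeff a = fact (2 * a) / (4 ^ a * fact a ^ 2)"
    using sqrt_coeff_fact[of a] by (simp add: field_simps)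
  moreover have "of_nat (n + 1) * fact q * fact (2 * n + 1) \<noteq> (0 :: rat)"
    by (simp del: of_nat_Suc of_nat_add)
  ultimately have "r = fact (2 * a) / (4 ^ a * fact a ^ 2) * (2 * of_nat a + 1) * (of_nat a + 1)
      * 4 ^ n * fact M / (of_nat (n + 1) * fact q * fact (2 * n + 1))"
    by (metis nonzero_eq_divide_eq)
  also have "\<dots> = K n * (fact (a + 1) * fact (2 * a + 1) * fact n * fact (3 * n - a) /
      (4 ^ a * fact a ^ 3 * fact (n - a) * fact (3 * n)))"
  proof -
    have e: "fact (a + 1) = (of_nat a + 1) * (fact a :: rat)"
      "fact (2 * a + 1) = (2 * of_nat a + 1) * (fact (2 * a) :: rat)"
      "fact (n + 1) = of_nat (n + 1) * (fact n :: rat)" by (simp_all add: algebra_simps)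
    have f: "fact (3 * n - a) = (fact M :: rat)" "fact (n - a) = (fact q :: rat)"
      by (simp_all only: m M_def q_def)
    show ?thesis
      unfolding K_def e f
      by (simp add: divide_simps power2_eq_square power3_eq_cube del: of_nat_add fact_Suc)
  qed
  finally show ?thesis by (simp add: r_def M_def m)
qed

section \<open>Summation over the diagonal\<close>

lemma T_eq_pochhammer:
  "T n = 4 ^ n * (7 * of_nat n + 5) * pochhammer (2 * of_nat n + 5 / 2) n /
     (fact (n + 1) * (2 * of_nat n + 1) * (4 * of_nat n + 5))"
proof -
  let ?P = "\<lambda>n. pochhammer (2 * of_nat n + 5 / 2) n :: rat"
  have "(\<Prod>k=1..n. 6 * (2 * of_nat k - 1) * (6 * of_nat k - 1) * (6 * of_nat k + 1) /
        ((of_nat k + 1) * (4 * of_nat k + 3) * (4 * of_nat k + 5))) * (fact (n + 1) * (2 * of_nat n + 1) * (4 * of_nat n + 5)) = 5 * 4 ^ n * ?P n"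
  proof (induction n)
    case 0
    show ?case by simp
  next
    case (Suc n)
    define N :: rat where "N = of_nat n"
    have N0: "N \<ge> 0" by (simp add: N_def)
    define p where "p = (\<Prod>k=1..n. 6 * (2 * of_nat k - 1) * (6 * of_nat k - 1) * (6 * of_nat k + 1) /
        ((of_nat k + 1) * (4 * of_nat k + 3) * (4 * of_nat k + 5)) :: rat)"
    have IH: "p * (fact (n + 1) * (2 * N + 1) * (4 * N + 5)) = 5 * 4 ^ n * ?P n"
      using Suc unfolding p_def N_def .
    have P: "?P (Suc n) * ((2 * N + 5 / 2) * (2 * N + 7 / 2)) =
        ?P n * ((3 * N + 5 / 2) * (3 * N + 7 / 2) * (3 * N + 9 / 2))"
    proof -
      define z where "z = 2 * N + 5 / 2"
      have "pochhammer z (2 + Suc n) = pochhammer z 2 * pochhammer (z + of_nat 2) (Suc n)"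
        by (rule pochhammer_product')
      moreover have "pochhammer z (n + 3) = pochhammer z n * pochhammer (z + of_nat n) 3"
        by (rule pochhammer_product')
      moreover have "2 + Suc n = n + 3" by simp
      moreover have "pochhammer z 2 = (2 * N + 5 / 2) * (2 * N + 7 / 2)"
        by (simp add: z_def numeral_2_eq_2 pochhammer_Suc algebra_simps)
      moreover have "pochhammer (z + of_nat n) 3 = (3 * N + 5 / 2) * (3 * N + 7 / 2) * (3 * N + 9 / 2)"
        by (simp add: z_def N_def numeral_3_eq_3 pochhammer_Suc algebra_simps)
      moreover have "pochhammer (z + of_nat 2) (Suc n) = ?P (Suc n)" "pochhammer z n = ?P n"
        by (simp_all add: z_def N_def algebra_simps)
      ultimately show ?thesis by (simp only: mult.commute)
    qed
    have "p * (6 * (2 * (N + 1) - 1) * (6 * (N + 1) - 1) * (6 * (N + 1) + 1) /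
        ((N + 2) * (4 * (N + 1) + 3) * (4 * (N + 1) + 5))) *
      ((N + 2) * fact (n + 1) * (2 * (N + 1) + 1) * (4 * (N + 1) + 5)) = 5 * 4 ^ Suc n * ?P (Suc n)"
    proof -
      define f Z P0 P1 where "f = (fact (n + 1) :: rat)" and "Z = (4 ^ n :: rat)"
        and "P0 = ?P n" and "P1 = ?P (Suc n)"
      have nz: "4 * N + 5 \<noteq> 0" "N + 2 \<noteq> 0" "4 * N + 7 \<noteq> 0" "4 * N + 9 \<noteq> 0"
        using N0 by linarith+
      have IH': "p * (f * (2 * N + 1) * (4 * N + 5)) = 5 * Z * P0"
        using IH unfolding f_def Z_def P0_def .
      have "P1 * ((2 * N + 5 / 2) * (2 * N + 7 / 2)) =
          P0 * ((3 * N + 5 / 2) * (3 * N + 7 / 2) * (3 * N + 9 / 2))"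
        using P unfolding P0_def P1_def .
      then have P': "2 * (P1 * ((4 * N + 5) * (4 * N + 7))) = P0 * ((6 * N + 5) * (6 * N + 7) * (6 * N + 9))"
        by (simp add: field_simps)
      have "(4 * N + 5) * (p * (6 * (2 * N + 1) * (6 * N + 5) * (6 * N + 7)) * f * (2 * N + 3)) =
          (4 * N + 5) * (20 * Z * P1 * (4 * N + 7))"
        using IH' P' by algebra
      then have main: "p * (6 * (2 * N + 1) * (6 * N + 5) * (6 * N + 7)) * f * (2 * N + 3) =
          20 * Z * P1 * (4 * N + 7)"
        using nz by simp
      have "p * (6 * (2 * (N + 1) - 1) * (6 * (N + 1) - 1) * (6 * (N + 1) + 1) /
          ((N + 2) * (4 * (N + 1) + 3) * (4 * (N + 1) + 5))) *
          ((N + 2) * f * (2 * (N + 1) + 1) * (4 * (N + 1) + 5)) =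
          p * (6 * (2 * N + 1) * (6 * N + 5) * (6 * N + 7) /
          ((N + 2) * (4 * N + 7) * (4 * N + 9))) *
          ((N + 2) * f * (2 * N + 3) * (4 * N + 9))"
        by (simp add: algebra_simps)
      also have "\<dots> = p * (6 * (2 * N + 1) * (6 * N + 5) * (6 * N + 7)) * f * (2 * N + 3) / (4 * N + 7)"
        using nz by (simp add: divide_simps)
      also have "\<dots> = 5 * 4 ^ Suc n * P1"
        unfolding main using nz by (simp add: Z_def)
      finally show ?thesis unfolding f_def P1_def .
    qed
    then show ?case by (simp add: p_def N_def add.commute)
  qed
  moreover have "fact (n + 1) * (2 * of_nat n + 1) * (4 * of_nat n + 5) \<noteq> (0 :: rat)"
    using of_nat_0_le_iff[of n, where 'a=rat]
    by (metis add_nonneg_pos fact_nonzero less_irrefl mult_eq_0_iff mult_nonneg_nonneg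
        zero_le_numeral zero_less_numeral zero_less_one)
  ultimately have "(\<Prod>k=1..n. 6 * (2 * of_nat k - 1) * (6 * of_nat k - 1) * (6 * of_nat k + 1) /
        ((of_nat k + 1) * (4 * of_nat k + 3) * (4 * of_nat k + 5))) = 5 * 4 ^ n * ?P n /
        (fact (n + 1) * (2 * of_nat n + 1) * (4 * of_nat n + 5))"
    by (simp only: nonzero_eq_divide_eq not_False_eq_True)
  then show ?thesis
    unfolding T_def by (simp add: ac_simps)
qed

text \<open>
  With \<open>(a + 1) (3/2)\<^sub>a = 3/2 (5/2)\<^sub>a - 1/2 (3/2)\<^sub>a\<close> for rising factorials, the sum splits into two
  Chu-Vandermonde sums, whose closed forms differ by a rational factor.
\<close>

lemma rk_diagonal_sum: "(\<Sum>a=0..n. of_nat (rk (3 * n - a) a a)) = T n"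
proof -
  define N :: rat where "N = of_nat n"
  have N0: "N \<ge> 0" by (simp add: N_def)
  let ?c = "4 ^ n / (fact (n + 1) * (2 * N + 1)) :: rat"
  have summand: "of_nat (rk (3 * n - a) a a) =
      ?c * (3 / 2 * (of_nat (n choose a) * pochhammer (5 / 2) a * pochhammer (2 * N + 1) (n - a))
        - 1 / 2 * (of_nat (n choose a) * pochhammer (3 / 2) a * pochhammer (2 * N + 1) (n - a)))"
    if "a \<le> n" for a
  proof -
    define A :: rat where "A = of_nat a"
    have p3: "pochhammer (3 / 2) a = (2 * A + 1) * (pochhammer (1 / 2) a :: rat)"
      using pochhammer_rec[of "1 / 2 :: rat" a] pochhammer_Suc[of "1 / 2 :: rat" a]
      by (simp add: A_def field_simps)
    have p5: "3 / 2 * pochhammer (5 / 2) a = (A + 3 / 2) * (pochhammer (3 / 2) a :: rat)"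
      using pochhammer_rec[of "3 / 2 :: rat" a] pochhammer_Suc[of "3 / 2 :: rat" a]
      by (simp add: A_def field_simps)
    have ph: "(pochhammer (1 / 2) a :: rat) * 4 ^ a * fact a = fact (2 * a)"
      using sqrt_coeff_fact[of a] by (simp add: sqrt_coeff_def power2_eq_square)
    have pn: "fact (2 * n) * pochhammer (2 * N + 1) (n - a) = (fact (3 * n - a) :: rat)"
    proof -
      have "fact (2 * n + (n - a)) = (fact (2 * n) * pochhammer (1 + of_nat (2 * n)) (n - a) :: rat)"
        unfolding pochhammer_fact pochhammer_product' ..
      moreover have "2 * n + (n - a) = 3 * n - a" using that by simp
      ultimately show ?thesis by (simp add: N_def add.commute)
    qed
    have ph': "pochhammer (1 / 2) a = (fact (2 * a) / (4 ^ a * fact a) :: rat)"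
      using ph by (simp add: field_simps)
    have pn': "pochhammer (2 * N + 1) (n - a) = (fact (3 * n - a) / fact (2 * n) :: rat)"
      using pn by (simp add: field_simps)
    have e: "fact (a + 1) = (A + 1) * (fact a :: rat)"
      "fact (2 * a + 1) = (2 * A + 1) * (fact (2 * a) :: rat)"
      "fact (2 * n + 1) = (2 * N + 1) * (fact (2 * n) :: rat)"
      by (simp_all add: A_def N_def algebra_simps)
    have nz: "2 * N + 1 \<noteq> 0" using N0 by linarith
    define g h C where "g = (pochhammer (3 / 2) a :: rat)" and "h = (pochhammer (2 * N + 1) (n - a) :: rat)"
      and "C = (of_nat (n choose a) :: rat)"
    have "3 / 2 * (C * pochhammer (5 / 2) a * h) - 1 / 2 * (C * g * h)
        = C * h * ((3 / 2 * pochhammer (5 / 2) a) - 1 / 2 * g)"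
      by (simp add: algebra_simps)
    also have "\<dots> = C * h * ((A + 1) * g)"
      unfolding p5 g_def by (simp add: algebra_simps)
    finally have "3 / 2 * (C * pochhammer (5 / 2) a * h) - 1 / 2 * (C * g * h) = C * h * ((A + 1) * g)" .
    moreover have "of_nat (rk (3 * n - a) a a) = ?c * (C * h * ((A + 1) * g))"
      unfolding rk_diagonal[OF that] K_def C_def h_def g_def pn' p3 ph' e binomial_fact[OF that]
      using nz by (simp add: divide_simps power3_eq_cube del: fact_Suc)
    ultimately show ?thesis unfolding g_def h_def C_def by simp
  qed
  have "(\<Sum>a=0..n. of_nat (rk (3 * n - a) a a)) =
      (\<Sum>a=0..n. ?c * (3 / 2 * (of_nat (n choose a) * pochhammer (5 / 2) a * pochhammer (2 * N + 1) (n - a))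
        - 1 / 2 * (of_nat (n choose a) * pochhammer (3 / 2) a * pochhammer (2 * N + 1) (n - a))))"
    by (intro sum.cong refl summand) simp
  also have "\<dots> = ?c * (3 / 2 * pochhammer (5 / 2 + (2 * N + 1)) n - 1 / 2 * pochhammer (3 / 2 + (2 * N + 1)) n)"
    unfolding pochhammer_binomial_sum
    by (simp only: atLeast0AtMost sum_distrib_left[symmetric] sum_subtractf)
  also have "\<dots> = ?c * ((7 * N + 5) * pochhammer (2 * N + 5 / 2) n / (4 * N + 5))"
  proof -
    define P where "P = pochhammer (2 * N + 5 / 2) n"
    define P' where "P' = pochhammer (2 * N + 7 / 2) n"
    have "(2 * N + 5 / 2) * P' = P * (2 * N + 5 / 2 + N)"
      using pochhammer_rec[of "2 * N + 5 / 2" n] pochhammer_Suc[of "2 * N + 5 / 2" n]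
      by (simp add: P_def P'_def N_def add.assoc)
    then have "3 / 2 * P' - 1 / 2 * P = (7 * N + 5) * P / (4 * N + 5)"
      using N0 by (simp add: field_simps)
    moreover have "5 / 2 + (2 * N + 1) = 2 * N + 7 / 2" "3 / 2 + (2 * N + 1) = 2 * N + 5 / 2"
      by simp_all
    ultimately show ?thesis by (simp only: P_def P'_def)
  qed
  also have "\<dots> = T n" unfolding T_eq_pochhammer by (simp add: N_def)
  finally show ?thesis .
qed

section \<open>Closed form and algebraicity of the diagonal series\<close>

lemma sqrt_equation:
  assumes U: "U = fps_X * (2 + U ^ 3)"
  defines "u \<equiv> in_t U" and "S \<equiv> swap_series (sqrt_series U)"
  shows "2 * (S * (1 - ser_t * ser_x\<^sup>2 * Qd)) = 2 - ser_x * u\<^sup>2 - ser_x\<^sup>2 * u"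
    and "S\<^sup>2 = 1 - ser_x * u\<^sup>2"
proof -
  have "swap_series (2 * (S * (1 - ser_t * ser_x\<^sup>2 * Qd))) =
      swap_series (2 - ser_x * u\<^sup>2 - ser_x\<^sup>2 * u)"
    unfolding S_def u_def swap_series_simps swap_series_swap using diagonal_equation[OF U] by simp
  then show "2 * (S * (1 - ser_t * ser_x\<^sup>2 * Qd)) = 2 - ser_x * u\<^sup>2 - ser_x\<^sup>2 * u"
    unfolding swap_series_eq_iff .
  have "swap_series (S\<^sup>2) = swap_series (1 - ser_x * u\<^sup>2)"
    unfolding S_def u_def swap_series_simps swap_series_swap by (simp add: sqrt_series_square)
  then show "S\<^sup>2 = 1 - ser_x * u\<^sup>2" unfolding swap_series_eq_iff .
qed

text \<open>
  Squaring the equation of the diagonal and reducing modulo \<open>t U\<^sup>3 - U + 2 t = 0\<close> gives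
  \<open>\<alpha> U\<^sup>2 + \<beta> U + \<gamma> = 0\<close>. Multiplying by \<open>t U\<close> and by \<open>t U\<^sup>2\<close> and reducing again gives two more quadratic
  equations in \<open>U\<close>. The eliminant is the determinant of these three equations in \<open>U\<^sup>2\<close>, \<open>U\<close>, \<open>1\<close>. It is
  defined over any commutative ring, so that one definition serves for polynomials, series and
  rationals.
\<close>

definition eliminant :: "'a :: comm_ring_1 \<Rightarrow> 'a \<Rightarrow> 'a \<Rightarrow> 'a" where
  "eliminant x t q =
    (let z = (t * x * x * q - 1) * (t * x * x * q - 1);
         \<alpha> = 4 * t * x - 4 * t * x * z - x * x - t * x * x * x * x;
         \<beta> = 6 * t * x * x - 2 * x * x * x;
         \<gamma> = 4 * t * z + 4 * t * x * x * x - 4 * t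
     in \<alpha> * (2 * t * \<alpha> * (\<beta> - 2 * t * \<alpha>) - 2 * t * \<beta> * (t * \<gamma> + \<alpha>))
        - \<beta> * (2 * t * \<alpha> * (t * \<gamma> + \<alpha>) - 2 * t * \<beta> * (t * \<beta>))
        + \<gamma> * (t * \<beta> * (\<beta> - 2 * t * \<alpha>) - (t * \<gamma> + \<alpha>) * (t * \<gamma> + \<alpha>)))"

lemma eliminant_eq_0:
  fixes x t q u :: "'a :: idom"
  assumes cubic: "u = t * (2 + u ^ 3)"
    and eq: "4 * (1 - x * u\<^sup>2) * (1 - t * x\<^sup>2 * q)\<^sup>2 = (2 - x * u\<^sup>2 - x\<^sup>2 * u)\<^sup>2"
  shows "eliminant x t q = 0"
proof -
  define z where "z = (t * x * x * q - 1) * (t * x * x * q - 1)"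
  define a where "a = 4 * t * x - 4 * t * x * z - x * x - t * x * x * x * x"
  define b where "b = 6 * t * x * x - 2 * x * x * x"
  define c where "c = 4 * t * z + 4 * t * x * x * x - 4 * t"
  have "z = (1 - t * x\<^sup>2 * q)\<^sup>2" unfolding z_def by algebra
  then have eq': "4 * (1 - x * u\<^sup>2) * z = (2 - x * u\<^sup>2 - x\<^sup>2 * u)\<^sup>2" using eq by simp
  have e1: "a * u\<^sup>2 + b * u + c = 0"
    using eq' cubic unfolding a_def b_def c_def by algebra
  have e2: "t * b * u\<^sup>2 + (t * c + a) * u - 2 * t * a = 0"
    using e1 cubic by algebra
  have e3: "(t * c + a) * u\<^sup>2 + (b - 2 * t * a) * u - 2 * t * b = 0"
    using e2 cubic e1 by algebra
  \<comment> \<open>Expansion along the column of constants: the coefficients are its cofactors.\<close>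
  have "eliminant x t q =
      (t * b * (b - 2 * t * a) - (t * c + a) * (t * c + a)) * (a * u\<^sup>2 + b * u + c)
      - (a * (b - 2 * t * a) - b * (t * c + a)) * (t * b * u\<^sup>2 + (t * c + a) * u - 2 * t * a)
      + (a * (t * c + a) - b * (t * b)) * ((t * c + a) * u\<^sup>2 + (b - 2 * t * a) * u - 2 * t * b)"
    unfolding eliminant_def Let_def z_def[symmetric]
    unfolding a_def[symmetric] b_def[symmetric] c_def[symmetric]
    by algebra
  then show ?thesis unfolding e1 e2 e3 by simp
qed

lemma ser_of_poly_add: "ser_of_poly (p + q) = ser_of_poly p + ser_of_poly q"
  by (rule fps_ext)
     (simp add: ser_of_poly_def coeff_map_poly fps_of_poly_add)

lemma ser_of_poly_mult: "ser_of_poly (p * q) = ser_of_poly p * ser_of_poly q"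
  by (rule fps_ext)
     (simp add: ser_of_poly_def coeff_map_poly coeff_mult fps_mult_nth fps_of_poly_sum fps_of_poly_mult
        atLeast0AtMost)

lemma ser_of_poly_0: "ser_of_poly 0 = 0" by (simp add: ser_of_poly_def)
lemma ser_of_poly_1: "ser_of_poly 1 = 1" by (simp add: ser_of_poly_def)

lemma ser_of_poly_sum: "ser_of_poly (\<Sum>i\<in>A. f i) = (\<Sum>i\<in>A. ser_of_poly (f i))"
  by (induction A rule: infinite_finite_induct) (simp_all add: ser_of_poly_add ser_of_poly_0)

text \<open>
  The value at \<open>F\<close> of a polynomial with coefficients in \<open>\<rat>[x, t]\<close>; a ring homomorphism.
\<close>

definition eval_at :: "rat fps fps \<Rightarrow> rat poly poly poly \<Rightarrow> rat fps fps" where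
  "eval_at F P = poly (map_poly ser_of_poly P) F"

lemma eval_at_add: "eval_at F (P + Q) = eval_at F P + eval_at F Q"
proof -
  have "map_poly ser_of_poly (P + Q) = map_poly ser_of_poly P + map_poly ser_of_poly Q"
    by (rule poly_eqI) (simp add: coeff_map_poly ser_of_poly_0 ser_of_poly_add)
  then show ?thesis by (simp add: eval_at_def)
qed

lemma eval_at_mult: "eval_at F (P * Q) = eval_at F P * eval_at F Q"
proof -
  have "map_poly ser_of_poly (P * Q) = map_poly ser_of_poly P * map_poly ser_of_poly Q"
    by (rule poly_eqI)
       (simp add: coeff_map_poly coeff_mult ser_of_poly_0 ser_of_poly_sum ser_of_poly_mult)
  then show ?thesis by (simp add: eval_at_def)
qed

lemma eval_at_1: "eval_at F 1 = 1"
  by (simp add: eval_at_def ser_of_poly_1 map_poly_1')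

lemma eval_at_diff: "eval_at F (P - Q) = eval_at F P - eval_at F Q"
  using eval_at_add[of F "P - Q" Q] by simp

lemma eval_at_numeral: "eval_at F (numeral k) = numeral k"
  by (induction k) (simp_all only: numeral.simps eval_at_1 eval_at_add)

lemma eval_at_eliminant: "eval_at F (eliminant x t q) = eliminant (eval_at F x) (eval_at F t) (eval_at F q)"
  by (simp only: eliminant_def Let_def eval_at_add eval_at_diff eval_at_mult eval_at_numeral eval_at_1)

lemma algebraic_series_Qd: "algebraic_series Qd"
proof -
  obtain U :: "rat fps" where U: "U = fps_X * (2 + U ^ 3)"
    using cubic_series_ex1 by blast
  define P :: "rat poly poly poly" where
    "P = eliminant [:[:[:0, 1:]:]:] [:[:0, 1:]:] [:0, 1:]"
  have "eval_at Qd P = eliminant ser_x ser_t Qd"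
  proof -
    have "eval_at Qd [:[:[:0, 1:]:]:] = ser_x"
      by (simp add: eval_at_def map_poly_pCons ser_of_poly_def ser_x_def fps_of_poly_pCons)
    moreover have "eval_at Qd [:[:0, 1:]:] = ser_t"
      by (simp add: eval_at_def map_poly_pCons ser_of_poly_def ser_t_def fps_of_poly_pCons)
    moreover have "eval_at Qd [:0, 1:] = Qd"
      by (simp add: eval_at_def map_poly_pCons ser_of_poly_0 ser_of_poly_1)
    ultimately show ?thesis by (simp only: P_def eval_at_eliminant)
  qed
  also have "\<dots> = 0"
  proof (rule eliminant_eq_0[OF in_t_equation[OF U]])
    show "4 * (1 - ser_x * (in_t U)\<^sup>2) * (1 - ser_t * ser_x\<^sup>2 * Qd)\<^sup>2 =
        (2 - ser_x * (in_t U)\<^sup>2 - ser_x\<^sup>2 * in_t U)\<^sup>2"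
      using sqrt_equation[OF U] by algebra
  qed
  finally have "poly (map_poly ser_of_poly P) Qd = 0" by (simp add: eval_at_def)
  \<comment> \<open>Nonvanishing is seen at \<open>x = 1\<close>, \<open>t = 1\<close>, \<open>q = 2\<close>.\<close>
  moreover have "poly (poly (poly P [:[:2:]:]) [:1:]) 1 = 368"
    by (simp add: P_def eliminant_def Let_def)
  then have "P \<noteq> 0" by auto
  ultimately show ?thesis unfolding algebraic_series_def by blast
qed

lemma to_fract_numeral: "to_fract (numeral k) = numeral k"
  by (induction k) (simp_all only: numeral.simps to_fract_1 to_fract_add)

lemma to_fract_power: "to_fract (a ^ n) = to_fract a ^ n"
  by (induction n) simp_all

lemma to_fract_Qd:
  assumes U: "U = fps_X * (2 + U ^ 3)"
  shows "let x = to_fract ser_x; t = to_fract ser_t; u = to_fract (in_t U);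
            r = to_fract (ser_sqrt (1 - ser_x * (in_t U)\<^sup>2))
        in to_fract Qd =
             1 / r * (u / (2 * t) + (r - 1 + 1 / 2 * x * u\<^sup>2) / (t * x\<^sup>2))"
proof -
  define S where "S = swap_series (sqrt_series U)"
  define x t u r Q where "x = to_fract ser_x" and "t = to_fract ser_t" and "u = to_fract (in_t U)"
    and "r = to_fract S" and "Q = to_fract Qd"
  have eq: "2 * (r * (1 - t * x\<^sup>2 * Q)) = 2 - x * u\<^sup>2 - x\<^sup>2 * u"
    using arg_cong[OF sqrt_equation(1)[OF U], of to_fract]
    unfolding x_def t_def u_def r_def Q_def S_def
    by (simp only: to_fract_mult to_fract_diff to_fract_power to_fract_numeral to_fract_1)
  have "S $ 0 $ 0 = 1" by (simp add: S_def swap_series_nth sqrt_series_low)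
  then have "S \<noteq> 0" by auto
  then have nz: "x \<noteq> 0" "t \<noteq> 0" "r \<noteq> 0"
    by (simp_all add: x_def t_def r_def ser_x_def ser_t_def)
  have two: "(2 :: rat fps fps fract) \<noteq> 0"
    using to_fract_eq_0_iff[of "2 :: rat fps fps"] by (simp add: to_fract_numeral)
  have "Q = (x\<^sup>2 * u + 2 * (r - 1) + x * u\<^sup>2) / (2 * r * t * x\<^sup>2)"
    using nz two eq by (simp add: eq_divide_eq algebra_simps)
  also have "\<dots> = 1 / r * (u / (2 * t) + (r - 1 + 1 / 2 * x * u\<^sup>2) / (t * x\<^sup>2))"
    using nz two by (simp add: divide_simps)
  finally show ?thesis
    unfolding Let_def ser_sqrt_eq x_def t_def u_def r_def Q_def S_def .
qed

theorem theorem7p2: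
  shows "(\<forall>n. (\<Sum>a=0..n. of_nat (rk (3 * n - a) a a)) = T n) \<and>
    (\<forall>n a. a \<le> n \<longrightarrow>
       of_nat (rk (3 * n - a) a a) =
         K n * (fact (a + 1) * fact (2 * a + 1) * fact n * fact (3 * n - a) /
                (4 ^ a * fact a ^ 3 * fact (n - a) * fact (3 * n)))) \<and>
    algebraic_series Qd \<and>
    (\<exists>!U :: rat fps. U = fps_X * (2 + U ^ 3)) \<and>
    (\<forall>U :: rat fps. U = fps_X * (2 + U ^ 3) \<longrightarrow>
       (let x = to_fract ser_x; t = to_fract ser_t; u = to_fract (in_t U);
            r = to_fract (ser_sqrt (1 - ser_x * (in_t U)\<^sup>2))
        in to_fract Qd =
             1 / r * (u / (2 * t) + (r - 1 + 1 / 2 * x * u\<^sup>2) / (t * x\<^sup>2))))"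
  using rk_diagonal_sum rk_diagonal algebraic_series_Qd cubic_series_ex1 to_fract_Qd
  by (intro conjI) blast+

end
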